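(* Let $G$ be a graph, $S_0\subset E(G)$ and $\gamma:G\to H=G/S_0$ the contraction of $S_0$. Let $b\in\{0,1\}$. (a) Let $b=0$. Then we have a morphism of posets $$\overline\gamma_*:\overline{\mathcal{OP}}^0_G\to\overline{\mathcal{OP}}^0_H,\qquad \overline O_S\mapsto\overline{\gamma_*O_S}.$$ (b) Let $b=1$ and $S_0\ne E(G)$. Then we have a morphism of posets $$\overline\gamma_*:\overline{\mathcal{OP}}^1_G\to\overline{\mathcal{OP}}^1_H,\qquad \overline O_S\mapsto\overline{\gamma_*O'_S}$$ for any $O'_S\sim O_S$ whose bioriented edge is not in $S_0$. (c) Let $b\in\{0,1\}$ and let $\delta:H\to H/T_0$ be a contraction; if $b=1$ assume $T_0\ne E(H)$. Then $\overline{(\delta\circ\gamma)}_*=\overline\delta_*\circ\overline\gamma_*$.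
   Context: **Graphs.** A graph $G$ is finite, with vertex set $V$, edge set $E$, weight function $w:V\to\mathbb N$; loops and multiple edges are allowed; each edge consists of two half-edges with ends in $V$. The genus is $g(G)=\sum_v w(v)-|V|+|E|+c(G)$, with $c(G)$ the number of connected components. $G-S$ is $G$ with the edges of $S$ deleted. For $\emptyset\neq Z\subsetneq V$, the cut $E(Z,Z^c)$ is the set of edges joining $Z$ to $Z^c=V\setminus Z$; a bridge is an edge $e$ such that $\{e\}$ is a cut. $G[Z]$ is the induced subgraph. $G/S_0$ is obtained by contracting every edge of $S_0$; $E(G/S_0)=E(G)\setminus S_0$; the weight of a vertex $v$ of $G/S_0$ is the genus of the subgraph of $G$ which gets contracted into $v$. **Orientations.** A generalized orientation assigns to each edge one direction or both (bioriented: both ends are sources and targets); a $b$-orientation has exactly $b$ bioriented edges. A $0$-orientation is totally cyclic if every nonempty cut $E(Z,Z^c)$ has an edge with target in $Z$ and one with target in $Z^c$. A $1$-orientation with bioriented edge $e$ is rooted if for every $Z\subsetneq V$ with $e\in G[Z]$ the cut $E(Z,Z^c)$ has an edge with target in $Z^c$. $\mathcal O^0(G)$, $\mathcal O^1(G)$: sets of totally cyclic $0$-orientations, resp. rooted $1$-orientations. If $G$ has no edges, $\mathcal O^0(G)$ consists of the empty orientation; if $G$ is a single vertex without edges, the empty orientation is also considered rooted, and $\mathcal O^1(G)=\mathcal O^0(G)$. For $O\in\mathcal O^b(G)$: $\underline d^O\in\mathbb Z^V$, $\underline d^O_v=w(v)-1+\underline t^O_v$ with $\underline t^O_v$ the number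 of half-edges with target $v$ if $E\ne\emptyset$, and $\underline d^O_v=w(v)-1+b$ if $E=\emptyset$. $O\sim O'$ iff $\underline d^O=\underline d^{O'}$; $\overline O$ is the class, $\overline{\mathcal O}^b(G)=\mathcal O^b(G)/\sim$. The subscript in $O_S$ means the orientation is on $G-S$. **Posets.** $\mathcal A^0_G=\{S\subset E:G-S\text{ has no bridges}\}$, $\mathcal A^1_G=\{S\subset E:G-S\text{ connected}\}$. $\overline{\mathcal{OP}}^b_G=\bigsqcup_{S\in\mathcal A^b_G}\overline{\mathcal O}^b(G-S)$, with $\overline O_S\le\overline O_T$ iff $T\subset S$ and there exist $O'_S\sim O_S$, $O'_T\sim O_T$ with $(O'_T)_{|G-S}=O'_S$. A morphism of posets is an order-preserving map. **Push-forward.** $\gamma_*S=S\setminus S_0$ (it lies in $\mathcal A^b_H$ for $S\in\mathcal A^b_G$), and $\gamma_*O_S$ is the restriction of $O_S$ to $H-\gamma_*S$, using $E(H-\gamma_*S)=E(G)\setminus(S\cup S_0)\subset E(G-S)$.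
   Formalization: In (b), when all edges of G−S lie in S_0 (possible even if S_0 ≠ E(G)), no O'_S whose bioriented edge lies outside S_0 need exist; there any representative is allowed, and the image is the class of the empty orientation on the single vertex H−γ_*S. *)

theory Defs
  imports Main "HOL-Library.FuncSet"
begin

(* The two half-edges of an edge e are (e, False) and (e, True); half_end gives the vertex at which
   a half-edge ends. Loops and multiple edges are thereby allowed. *)
record ('v, 'e) mgraph =
  verts :: "'v set"
  edges :: "'e set"
  weight :: "'v \<Rightarrow> nat"
  half_end :: "'e \<times> bool \<Rightarrow> 'v"

definition wf_graph :: "('v, 'e) mgraph \<Rightarrow> bool" where
  "wf_graph G \<longleftrightarrow> finite (verts G) \<and> finite (edges G) \<and>
     (\<forall>h \<in> edges G \<times> UNIV. half_end G h \<in> verts G)"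

definition delete :: "('v, 'e) mgraph \<Rightarrow> 'e set \<Rightarrow> ('v, 'e) mgraph" where
  "delete G S = G\<lparr>edges := edges G - S\<rparr>"

definition induced :: "('v, 'e) mgraph \<Rightarrow> 'v set \<Rightarrow> ('v, 'e) mgraph" where
  "induced G Z = G\<lparr>verts := Z, edges := {e \<in> edges G. \<forall>i. half_end G (e, i) \<in> Z}\<rparr>"

definition linked :: "('v, 'e) mgraph \<Rightarrow> ('v \<times> 'v) set" where
  "linked G = {(half_end G (e, i), half_end G (e, \<not> i)) | e i. e \<in> edges G}\<^sup>* \<inter> verts G \<times> verts G"

definition components :: "('v, 'e) mgraph \<Rightarrow> 'v set set" where
  "components G = verts G // linked G"

definition connected_graph :: "('v, 'e) mgraph \<Rightarrow> bool" where
  "connected_graph G \<longleftrightarrow> card (components G) = 1"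

definition genus :: "('v, 'e) mgraph \<Rightarrow> int" where
  "genus G = (\<Sum>v\<in>verts G. int (weight G v)) - int (card (verts G)) + int (card (edges G))
     + int (card (components G))"

definition cut :: "('v, 'e) mgraph \<Rightarrow> 'v set \<Rightarrow> 'e set" where
  "cut G Z = {e \<in> edges G. \<exists>i. half_end G (e, i) \<in> Z \<and> half_end G (e, \<not> i) \<in> verts G - Z}"

definition bridge :: "('v, 'e) mgraph \<Rightarrow> 'e \<Rightarrow> bool" where
  "bridge G e \<longleftrightarrow> (\<exists>Z. Z \<noteq> {} \<and> Z \<subset> verts G \<and> cut G Z = {e})"

(* The vertices of G / S are the connected components of the spanning subgraph with edge set S.
   The coercion nat loses nothing, since the genus of a graph is never negative. *)
definition contract :: "('v, 'e) mgraph \<Rightarrow> 'e set \<Rightarrow> ('v set, 'e) mgraph" where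
  "contract G S = (let K = delete G (edges G - S) in
     \<lparr>verts = components K,
      edges = edges G - S,
      weight = (\<lambda>Z. nat (genus (induced K Z))),
      half_end = (\<lambda>h. linked K `` {half_end G h})\<rparr>)"

(* A generalized orientation is encoded by its set of target half-edges: (e, i) is in the set iff e
   is directed towards its half-edge (e, i). Each edge contains one or two target half-edges, and it
   is bioriented in the latter case. *)
type_synonym 'e orientation = "('e \<times> bool) set"

definition gen_orientation :: "('v, 'e) mgraph \<Rightarrow> 'e orientation \<Rightarrow> bool" where
  "gen_orientation G \<omega> \<longleftrightarrow> \<omega> \<subseteq> edges G \<times> UNIV \<and> (\<forall>e\<in>edges G. \<exists>i. (e, i) \<in> \<omega>)"

definition bioriented :: "'e orientation \<Rightarrow> 'e set" where
  "bioriented \<omega> = {e. \<forall>i. (e, i) \<in> \<omega>}"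

definition b_orientation :: "nat \<Rightarrow> ('v, 'e) mgraph \<Rightarrow> 'e orientation \<Rightarrow> bool" where
  "b_orientation b G \<omega> \<longleftrightarrow> gen_orientation G \<omega> \<and> card (bioriented \<omega>) = b"

definition restrict_orientation :: "'e orientation \<Rightarrow> ('v, 'e) mgraph \<Rightarrow> 'e orientation" where
  "restrict_orientation \<omega> G = \<omega> \<inter> edges G \<times> UNIV"

definition has_target_in :: "('v, 'e) mgraph \<Rightarrow> 'e orientation \<Rightarrow> 'e \<Rightarrow> 'v set \<Rightarrow> bool" where
  "has_target_in G \<omega> e Z \<longleftrightarrow> (\<exists>i. (e, i) \<in> \<omega> \<and> half_end G (e, i) \<in> Z)"

definition totally_cyclic :: "('v, 'e) mgraph \<Rightarrow> 'e orientation \<Rightarrow> bool" where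
  "totally_cyclic G \<omega> \<longleftrightarrow>
     (\<forall>Z. Z \<noteq> {} \<and> Z \<subset> verts G \<and> cut G Z \<noteq> {} \<longrightarrow>
        (\<exists>e\<in>cut G Z. has_target_in G \<omega> e Z) \<and>
        (\<exists>e\<in>cut G Z. has_target_in G \<omega> e (verts G - Z)))"

definition rooted_at :: "('v, 'e) mgraph \<Rightarrow> 'e orientation \<Rightarrow> 'e \<Rightarrow> bool" where
  "rooted_at G \<omega> e \<longleftrightarrow>
     (\<forall>Z. Z \<subset> verts G \<and> e \<in> edges (induced G Z) \<longrightarrow>
        (\<exists>e'\<in>cut G Z. has_target_in G \<omega> e' (verts G - Z)))"

definition orients0 :: "('v, 'e) mgraph \<Rightarrow> 'e orientation set" where
  "orients0 G = {\<omega>. b_orientation 0 G \<omega> \<and> totally_cyclic G \<omega>}"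

definition orients1 :: "('v, 'e) mgraph \<Rightarrow> 'e orientation set" where
  "orients1 G = (if card (verts G) = 1 \<and> edges G = {} then orients0 G
     else {\<omega>. b_orientation 1 G \<omega> \<and> (\<forall>e\<in>bioriented \<omega>. rooted_at G \<omega> e)})"

(* From here on, b is meant to be 0 or 1. *)
definition orients :: "nat \<Rightarrow> ('v, 'e) mgraph \<Rightarrow> 'e orientation set" where
  "orients b G = (if b = 0 then orients0 G else orients1 G)"

definition orient_div :: "nat \<Rightarrow> ('v, 'e) mgraph \<Rightarrow> 'e orientation \<Rightarrow> 'v \<Rightarrow> int" where
  "orient_div b G \<omega> v = int (weight G v) - 1 +
     (if edges G = {} then int b else int (card {h \<in> \<omega>. half_end G h = v}))"

definition orient_equiv :: "nat \<Rightarrow> ('v, 'e) mgraph \<Rightarrow> ('e orientation \<times> 'e orientation) set" where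
  "orient_equiv b G = {(\<omega>, \<omega>'). \<omega> \<in> orients b G \<and> \<omega>' \<in> orients b G \<and>
     (\<forall>v\<in>verts G. orient_div b G \<omega> v = orient_div b G \<omega>' v)}"

abbreviation orient_class :: "nat \<Rightarrow> ('v, 'e) mgraph \<Rightarrow> 'e orientation \<Rightarrow> 'e orientation set" where
  "orient_class b G \<omega> \<equiv> orient_equiv b G `` {\<omega>}"

definition adm_sets :: "nat \<Rightarrow> ('v, 'e) mgraph \<Rightarrow> 'e set set" where
  "adm_sets b G = {S. S \<subseteq> edges G \<and>
     (if b = 0 then \<forall>e. \<not> bridge (delete G S) e else connected_graph (delete G S))}"

(* An element of the disjoint union over S is a pair of S and an equivalence class on G - S. *)
definition OP :: "nat \<Rightarrow> ('v, 'e) mgraph \<Rightarrow> ('e set \<times> 'e orientation set) set" where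
  "OP b G = (SIGMA S:adm_sets b G. orients b (delete G S) // orient_equiv b (delete G S))"

fun OP_le :: "('v, 'e) mgraph \<Rightarrow> 'e set \<times> 'e orientation set \<Rightarrow> 'e set \<times> 'e orientation set \<Rightarrow> bool"
  where
  "OP_le G (S, C) (T, D) \<longleftrightarrow> T \<subseteq> S \<and>
     (\<exists>\<omega>\<^sub>S\<in>C. \<exists>\<omega>\<^sub>T\<in>D. restrict_orientation \<omega>\<^sub>T (delete G S) = \<omega>\<^sub>S)"

(* The image of an orientation on G - S under the contraction of S0. *)
definition push_orient ::
  "('v, 'e) mgraph \<Rightarrow> 'e set \<Rightarrow> 'e set \<Rightarrow> 'e orientation \<Rightarrow> 'e orientation" where
  "push_orient G S0 S \<omega> = restrict_orientation \<omega> (delete (contract G S0) (S - S0))"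

(* The representatives of a class on G - S whose restriction is used to push the class forward. For
   b = 0 there are no bioriented edges and every orientation qualifies. For b = 1 the bioriented edge
   must not be contracted; if every edge of G - S is contracted, no such representative need exist,
   but then every restriction is the empty orientation and every representative is accepted. *)
definition pushable :: "('v, 'e) mgraph \<Rightarrow> 'e set \<Rightarrow> 'e set \<Rightarrow> 'e orientation \<Rightarrow> bool" where
  "pushable G S0 S \<omega> \<longleftrightarrow> bioriented \<omega> \<inter> S0 = {} \<or> edges (delete G S) \<subseteq> S0"

(* The union of the classes of all push-forwards; it is a single class exactly if there is a
   representative to push forward and the result does not depend on its choice. *)
fun push_class ::
  "nat \<Rightarrow> ('v, 'e) mgraph \<Rightarrow> 'e set \<Rightarrow> 'e set \<times> 'e orientation set \<Rightarrow> 'e set \<times> 'e orientation set"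
  where
  "push_class b G S0 (S, C) = (S - S0,
     \<Union>\<omega> \<in> {\<omega> \<in> C. pushable G S0 S \<omega>}.
       orient_class b (delete (contract G S0) (S - S0)) (push_orient G S0 S \<omega>))"

definition poset_morphism ::
  "'a set \<Rightarrow> ('a \<Rightarrow> 'a \<Rightarrow> bool) \<Rightarrow> 'b set \<Rightarrow> ('b \<Rightarrow> 'b \<Rightarrow> bool) \<Rightarrow> ('a \<Rightarrow> 'b) \<Rightarrow> bool" where
  "poset_morphism A leA B leB f \<longleftrightarrow> f \<in> A \<rightarrow> B \<and> monotone_on A leA leB f"

end

theory Submission imports Defs begin

text \<open>Cuts of \<open>H - \<gamma>\<^sub>*S\<close> are cuts of \<open>G - S\<close>, so bridgelessness, connectedness, total cyclicity and
  rootedness pass to the quotient. A contracted edge that is not bioriented adds exactly one target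
  to the vertex it is contracted to, in either direction, so equivalent orientations have equivalent
  restrictions. For \<open>b = 1\<close> an equivalent orientation can be rooted at any prescribed edge, by moving
  the biorientation along directed paths; and the order relation can be realised by such
  representatives, because changing an orientation on \<open>G - S\<close> within its class keeps the orientation
  on \<open>G - T\<close> rooted for \<open>T \<subseteq> S\<close>. Functoriality reduces to the isomorphism between iterated and joint
  contraction, obtained from the universal property of contractions. Weights never matter, as they
  cancel when divisors are compared.\<close>

section \<open>Elementary facts on graphs, rootedness and orientations\<close>

lemma delete_simps [simp]:
  "verts (delete G S) = verts G" "edges (delete G S) = edges G - S"
  "weight (delete G S) = weight G" "half_end (delete G S) = half_end G"
  by (simp_all add: delete_def)

lemma edges_contract [simp]: "edges (contract G S) = edges G - S"
  by (simp add: contract_def Let_def)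

lemma wf_graph_delete: "wf_graph G \<Longrightarrow> wf_graph (delete G S)"
  by (auto simp: wf_graph_def)

lemma half_end_in_verts: "wf_graph G \<Longrightarrow> e \<in> edges G \<Longrightarrow> half_end G (e, i) \<in> verts G"
  by (auto simp: wf_graph_def)

lemma linked_edge:
  assumes "wf_graph G" "e \<in> edges G"
  shows "(half_end G (e, i), half_end G (e, j)) \<in> linked G"
proof (cases "i = j")
  case True
  then show ?thesis using half_end_in_verts[OF assms] by (auto simp: linked_def)
next
  case False
  then have "j = (\<not> i)" by auto
  then show ?thesis using half_end_in_verts[OF assms] assms(2)
    unfolding linked_def by auto
qed

lemma equiv_linked: "equiv (verts G) (linked G)"
proof -
  have "sym {(half_end G (e, i), half_end G (e, \<not> i)) | e i. e \<in> edges G}"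
    (is "sym ?r")
  proof (rule symI)
    fix x y assume "(x, y) \<in> ?r"
    then obtain e i where "x = half_end G (e, i)" "y = half_end G (e, \<not> i)" "e \<in> edges G" by auto
    then have "y = half_end G (e, \<not> i) \<and> x = half_end G (e, \<not> (\<not> i)) \<and> e \<in> edges G" by simp
    then show "(y, x) \<in> ?r" by blast
  qed
  then have "sym (linked G)"
    unfolding linked_def by (intro sym_Int sym_rtrancl) (assumption, rule symI, blast)
  moreover have "trans (linked G)"
    unfolding linked_def by (intro trans_Int trans_rtrancl) (rule transI, blast)
  moreover have "refl_on (verts G) (linked G)" "linked G \<subseteq> verts G \<times> verts G"
    unfolding linked_def by (auto simp: refl_on_def)
  ultimately show ?thesis by (simp add: equiv_def)
qed

text \<open>Trades the number of components for a relation on vertices, which maps of graphs can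
  transport. Nonemptiness is recorded because a graph without vertices has no component.\<close>

lemma connected_graph_iff:
  "connected_graph G \<longleftrightarrow> verts G \<noteq> {} \<and> verts G \<times> verts G \<subseteq> linked G"
proof
  assume "connected_graph G"
  then obtain X where X: "verts G // linked G = {X}"
    by (auto simp: connected_graph_def components_def card_1_singleton_iff)
  then have "verts G \<noteq> {}" by auto
  moreover have "(u, v) \<in> linked G" if "u \<in> verts G" "v \<in> verts G" for u v
  proof -
    have "linked G `` {u} = X" "linked G `` {v} = X"
      using X that by (auto intro: quotientI)
    then show ?thesis using that equiv_linked[of G] by (metis eq_equiv_class)
  qed
  ultimately show "verts G \<noteq> {} \<and> verts G \<times> verts G \<subseteq> linked G" by auto
next
  assume *: "verts G \<noteq> {} \<and> verts G \<times> verts G \<subseteq> linked G"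
  then have "linked G `` {v} = verts G" if "v \<in> verts G" for v
    using that by (auto simp: linked_def)
  then have "verts G // linked G = {verts G}"
    using * by (auto simp: quotient_def)
  then show "connected_graph G"
    by (simp add: connected_graph_def components_def)
qed

text \<open>Without edges, linked vertices are equal. Thus the exceptional clause of
  \<open>orients1\<close> covers every connected graph without edges.\<close>

lemma card_verts_connected_no_edges:
  assumes "connected_graph G" "edges G = {}"
  shows "card (verts G) = 1"
proof -
  obtain v where "v \<in> verts G" using assms(1) by (auto simp: connected_graph_iff)
  moreover have "linked G \<subseteq> Id" using assms(2) by (auto simp: linked_def)
  ultimately have "verts G = {v}" using assms(1) by (auto simp: connected_graph_iff)
  then show ?thesis by simp
qed

text \<open>Ends of edges are vertices, so an edge with a target outside \<open>Z\<close> and its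
  other end inside \<open>Z\<close> is automatically in the cut. Free of cuts, this form is easy to
  compare between orientations and between a graph and its spanning subgraphs.\<close>

lemma rooted_at_iff:
  assumes "wf_graph G" "e \<in> edges G"
  shows "rooted_at G \<omega> e \<longleftrightarrow> (\<forall>Z. Z \<subset> verts G \<and> (\<forall>i. half_end G (e, i) \<in> Z) \<longrightarrow>
    (\<exists>e'\<in>edges G. \<exists>i. (e', i) \<in> \<omega> \<and> half_end G (e', i) \<notin> Z \<and> half_end G (e', \<not> i) \<in> Z))"
proof -
  have "(\<exists>e'\<in>cut G Z. has_target_in G \<omega> e' (verts G - Z)) \<longleftrightarrow>
    (\<exists>e'\<in>edges G. \<exists>i. (e', i) \<in> \<omega> \<and> half_end G (e', i) \<notin> Z \<and> half_end G (e', \<not> i) \<in> Z)"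
    (is "?l \<longleftrightarrow> ?r") for Z
  proof
    assume ?l
    then obtain e' i j where e': "e' \<in> edges G" "(e', i) \<in> \<omega>" "half_end G (e', i) \<notin> Z"
      "half_end G (e', j) \<in> Z"
      by (auto simp: cut_def has_target_in_def)
    then have "j = (\<not> i)" by (cases i; cases j) auto
    with e' show ?r by blast
  next
    assume ?r
    then obtain e' i where e': "e' \<in> edges G" "(e', i) \<in> \<omega>" "half_end G (e', i) \<notin> Z"
      "half_end G (e', \<not> i) \<in> Z" by blast
    moreover have "half_end G (e', i) \<in> verts G" using e'(1) assms(1) half_end_in_verts by metis
    ultimately have "has_target_in G \<omega> e' (verts G - Z)" and
      "half_end G (e', \<not> i) \<in> Z \<and> half_end G (e', \<not> (\<not> i)) \<in> verts G - Z"
      by (auto simp: has_target_in_def)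
    with e' have "e' \<in> cut G Z" unfolding cut_def by blast
    then show ?l using \<open>has_target_in G \<omega> e' (verts G - Z)\<close> by blast
  qed
  then show ?thesis using assms(2) by (simp add: rooted_at_def induced_def)
qed

text \<open>Since \<open>card\<close> is also 0 on infinite sets, the finiteness of the edge set is
  what yields emptiness.\<close>

lemma b_orientation_0_iff:
  assumes "wf_graph G"
  shows "b_orientation 0 G \<omega> \<longleftrightarrow> gen_orientation G \<omega> \<and> bioriented \<omega> = {}"
proof -
  have "finite (bioriented \<omega>)" if "gen_orientation G \<omega>"
    using that assms by (auto simp: wf_graph_def gen_orientation_def bioriented_def
        intro!: finite_subset[of _ "edges G"])
  then show ?thesis by (auto simp: b_orientation_def)
qed

lemma bioriented_subset_edges: "gen_orientation G \<omega> \<Longrightarrow> bioriented \<omega> \<subseteq> edges G"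
  by (auto simp: gen_orientation_def bioriented_def)

lemma orients_0_iff:
  assumes "wf_graph G"
  shows "\<omega> \<in> orients 0 G \<longleftrightarrow> gen_orientation G \<omega> \<and> bioriented \<omega> = {} \<and> totally_cyclic G \<omega>"
  using b_orientation_0_iff[OF assms] by (auto simp: orients_def orients0_def)

lemma orients_1_iff:
  assumes "edges G \<noteq> {}"
  shows "\<omega> \<in> orients 1 G \<longleftrightarrow>
    gen_orientation G \<omega> \<and> (\<exists>e. bioriented \<omega> = {e} \<and> rooted_at G \<omega> e)"
  using assms by (auto simp: orients_def orients1_def b_orientation_def card_1_singleton_iff)

lemma gen_orientation_if_orients:
  assumes "\<omega> \<in> orients b G"
  shows "gen_orientation G \<omega>"
  using assms by (auto simp: orients_def orients0_def orients1_def b_orientation_def split: if_splits)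

text \<open>The exceptional clause of \<open>orients1\<close> applies, and total cyclicity is
  vacuous because all cuts are empty.\<close>

lemma orients_1_no_edges:
  assumes "connected_graph G" "edges G = {}"
  shows "orients 1 G = {{}}"
  using card_verts_connected_no_edges[OF assms] assms(2)
  by (auto simp: orients_def orients1_def orients0_def b_orientation_def gen_orientation_def
      bioriented_def totally_cyclic_def cut_def)

lemma equiv_orient_equiv: "equiv (orients b G) (orient_equiv b G)"
  by (auto simp: equiv_def refl_on_def sym_def trans_def orient_equiv_def)

text \<open>An edge selects the branch of \<open>orient_div\<close> that counts targets, and there
  the weights cancel. In the other branch all orientations of the graph have the same
  divisor.\<close>

lemma orient_equiv_iff:
  assumes "edges G \<noteq> {}"
  shows "(\<omega>, \<omega>') \<in> orient_equiv b G \<longleftrightarrow> \<omega> \<in> orients b G \<and> \<omega>' \<in> orients b G \<and>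
    (\<forall>v\<in>verts G. card {h \<in> \<omega>. half_end G h = v} = card {h \<in> \<omega>'. half_end G h = v})"
  using assms by (auto simp: orient_equiv_def orient_div_def)

lemma finite_orientation:
  assumes "wf_graph G" "gen_orientation G \<omega>"
  shows "finite \<omega>"
  using assms by (auto simp: wf_graph_def gen_orientation_def intro: finite_subset[of _ "edges G \<times> UNIV"])

section \<open>Moving the bioriented edge\<close>

text \<open>One target is exchanged for another at the common end, so no divisor changes. For
  rootedness, a set \<open>Z\<close> containing both ends of \<open>f\<close> contains the end
  \<open>(e, i)\<close>. Either \<open>e\<close> lies inside \<open>Z\<close> and the rootedness of
  \<omega> at \<open>e\<close> applies, or \<open>e\<close> itself, still directed to its other end,
  leaves \<open>Z\<close>.\<close>

lemma shift_bioriented: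
  assumes wf: "wf_graph G" and \<omega>: "\<omega> \<in> orients 1 G" and e: "bioriented \<omega> = {e}"
    and f: "f \<in> edges G" "(f, j) \<notin> \<omega>" and ends: "half_end G (f, j) = half_end G (e, i)"
  defines "\<omega>' \<equiv> insert (f, j) (\<omega> - {(e, i)})"
  shows "bioriented \<omega>' = {f}" "(\<omega>, \<omega>') \<in> orient_equiv 1 G"
proof -
  have ne: "edges G \<noteq> {}" using f by auto
  have gen: "gen_orientation G \<omega>" and root: "rooted_at G \<omega> e"
    using \<omega> e unfolding orients_1_iff[OF ne] by auto
  have eE: "e \<in> edges G" using bioriented_subset_edges[OF gen] e by auto
  have e\<omega>: "(e, k) \<in> \<omega>" for k using e by (auto simp: bioriented_def)
  have fe: "f \<noteq> e" using e\<omega> f by auto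
  have f\<omega>: "(f, \<not> j) \<in> \<omega>"
  proof -
    obtain k where "(f, k) \<in> \<omega>" using gen f by (auto simp: gen_orientation_def)
    then show ?thesis using f(2) by (cases j; cases k) auto
  qed
  show bi: "bioriented \<omega>' = {f}"
  proof -
    have "f \<in> bioriented \<omega>'"
      using f\<omega> fe by (cases j) (auto simp: bioriented_def \<omega>'_def all_bool_eq)
    moreover have "x = f" if "x \<in> bioriented \<omega>'" for x
    proof (rule ccontr)
      assume "x \<noteq> f"
      then have "(x, k) \<in> \<omega>" "(x, k) \<noteq> (e, i)" for k
        using that unfolding bioriented_def \<omega>'_def by blast+
      then have "x \<in> bioriented \<omega>" "x \<noteq> e" by (auto simp: bioriented_def)
      then show False using e by auto
    qed
    ultimately show ?thesis by blast
  qed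
  have gen': "gen_orientation G \<omega>'"
  proof -
    have "\<exists>k. (x, k) \<in> \<omega>'" if "x \<in> edges G" for x
    proof (cases "x = e")
      case True
      then show ?thesis using e\<omega> by (auto simp: \<omega>'_def intro!: exI[of _ "\<not> i"])
    next
      case False
      then show ?thesis using gen that by (auto simp: gen_orientation_def \<omega>'_def)
    qed
    then show ?thesis using gen f by (auto simp: gen_orientation_def \<omega>'_def)
  qed
  have "rooted_at G \<omega>' f"
    unfolding rooted_at_iff[OF wf f(1)]
  proof (intro allI impI)
    fix Z assume Z: "Z \<subset> verts G \<and> (\<forall>k. half_end G (f, k) \<in> Z)"
    then have iZ: "half_end G (e, i) \<in> Z" using ends by metis
    show "\<exists>e'\<in>edges G. \<exists>k. (e', k) \<in> \<omega>' \<and> half_end G (e', k) \<notin> Z \<and> half_end G (e', \<not> k) \<in> Z"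
    proof (cases "half_end G (e, \<not> i) \<in> Z")
      case True
      then have eZ: "\<forall>k. half_end G (e, k) \<in> Z" using iZ by (cases i) (auto simp: all_bool_eq)
      then obtain e' k where e': "e' \<in> edges G" "(e', k) \<in> \<omega>" "half_end G (e', k) \<notin> Z"
          "half_end G (e', \<not> k) \<in> Z"
        using spec[OF root[unfolded rooted_at_iff[OF wf eE]], of Z] Z by blast
      \<comment> \<open>Only the target \<open>(e, i)\<close> was removed, so the targets of
        \<open>e'\<close> survive in \<open>\<omega>'\<close>.\<close>
      then have "e' \<noteq> e" using eZ by auto
      then show ?thesis using e' by (auto simp: \<omega>'_def)
    next
      case False
      then show ?thesis using iZ eE e\<omega> by (auto simp: \<omega>'_def intro!: bexI[of _ e] exI[of _ "\<not> i"])
    qed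
  qed
  with gen' bi have "\<omega>' \<in> orients 1 G" unfolding orients_1_iff[OF ne] by auto
  moreover have "card {h \<in> \<omega>. half_end G h = v} = card {h \<in> \<omega>'. half_end G h = v}" for v
  proof (cases "v = half_end G (e, i)")
    case True
    define X where "X = {h \<in> \<omega>. half_end G h = v}"
    have fin: "finite X" using finite_orientation[OF wf gen] by (simp add: X_def)
    have mem: "(e, i) \<in> X" "(f, j) \<notin> X" using True e\<omega> f by (simp_all add: X_def)
    have "{h \<in> \<omega>'. half_end G h = v} = insert (f, j) (X - {(e, i)})"
      using True ends unfolding \<omega>'_def X_def by auto
    also have "card \<dots> = Suc (card (X - {(e, i)}))"
      using fin mem by (intro card_insert_disjoint) simp_all
    also have "\<dots> = card X" by (rule card_Suc_Diff1[OF fin mem(1)])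
    finally show ?thesis by (simp add: X_def)
  next
    case False
    then have "{h \<in> \<omega>. half_end G h = v} = {h \<in> \<omega>'. half_end G h = v}"
      using ends unfolding \<omega>'_def by auto
    then show ?thesis by simp
  qed
  ultimately show "(\<omega>, \<omega>') \<in> orient_equiv 1 G" using \<omega> unfolding orient_equiv_iff[OF ne] by auto
qed

text \<open>The biorientation is carried along directed paths of the original orientation. Orientations
  obtained on the way differ from it only on edges inside the set \<open>Z\<close> of vertices reached so far, so
  an edge that leaves \<open>Z\<close> in the original orientation still leaves \<open>Z\<close> in all of them.\<close>

lemma exists_equiv_bioriented_at:
  assumes wf: "wf_graph G" and \<omega>: "\<omega> \<in> orients 1 G" and f: "f \<in> edges G"
  shows "\<exists>\<omega>'. (\<omega>, \<omega>') \<in> orient_equiv 1 G \<and> bioriented \<omega>' = {f}"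
proof (rule ccontr)
  \<comment> \<open>The negated claim is used throughout: it prevents \<open>f\<close> from becoming
    bioriented on the way, so \<open>f\<close> keeps its original direction until the last
    step.\<close>
  assume contra: "\<not> ?thesis"
  have ne: "edges G \<noteq> {}" using f by auto
  obtain e where e: "bioriented \<omega> = {e}" and gen: "gen_orientation G \<omega>"
    and root: "rooted_at G \<omega> e"
    using \<omega> unfolding orients_1_iff[OF ne] by auto
  have eE: "e \<in> edges G" using bioriented_subset_edges[OF gen] e by auto
  have refl: "(\<omega>, \<omega>) \<in> orient_equiv 1 G" using \<omega> by (auto simp: orient_equiv_def)
  \<comment> \<open>The biorientation can be brought to an edge inside \<open>Z\<close> that has
    \<open>v\<close> as an end. The last clause preserves the original direction of \<open>f\<close>
    and of all edges not inside \<open>Z\<close>, which are the edges still to be used.\<close>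
  define reach where "reach Z v \<longleftrightarrow> (\<exists>\<omega>' x i. (\<omega>, \<omega>') \<in> orient_equiv 1 G \<and> bioriented \<omega>' = {x} \<and>
    half_end G (x, i) = v \<and> (\<forall>k. half_end G (x, k) \<in> Z) \<and>
    (\<forall>y k. y = f \<or> (\<exists>k. half_end G (y, k) \<notin> Z) \<longrightarrow> ((y, k) \<in> \<omega>' \<longleftrightarrow> (y, k) \<in> \<omega>)))" for Z v
  define good where "good Z \<longleftrightarrow> Z \<subseteq> verts G \<and> (\<forall>k. half_end G (e, k) \<in> Z) \<and> (\<forall>v\<in>Z. reach Z v)" for Z
  have "good {half_end G (e, k) | k. True}"
  proof -
    have "reach {half_end G (e, k) | k. True} (half_end G (e, k))" for k
      unfolding reach_def using refl e by (intro exI[of _ \<omega>] exI[of _ e] exI[of _ k]) auto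
    then show ?thesis unfolding good_def using half_end_in_verts[OF wf eE] by auto
  qed
  \<comment> \<open>A maximal good set replaces an induction along directed paths: any exit from it
    would enlarge it.\<close>
  moreover have "finite {Z. good Z}"
    using wf by (auto simp: good_def wf_graph_def intro!: finite_subset[of _ "Pow (verts G)"])
  ultimately obtain Z where Z: "good Z" and max: "\<And>Z'. good Z' \<Longrightarrow> Z \<subseteq> Z' \<Longrightarrow> Z = Z'"
    using finite_has_maximal[of "{Z. good Z}"] by blast
  have "Z = verts G"
  proof (rule ccontr)
    assume "Z \<noteq> verts G"
    then have "Z \<subset> verts G" using Z by (auto simp: good_def)
    moreover have eZ: "\<forall>k. half_end G (e, k) \<in> Z" using Z by (auto simp: good_def)
    ultimately obtain g j where g: "g \<in> edges G" "(g, j) \<in> \<omega>" "half_end G (g, j) \<notin> Z"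
      "half_end G (g, \<not> j) \<in> Z"
      using root unfolding rooted_at_iff[OF wf eE] by blast
    have "g \<noteq> e" using g eZ by auto
    then have "g \<notin> bioriented \<omega>" using e by auto
    then have g\<omega>: "(g, \<not> j) \<notin> \<omega>"
      using g(2) by (cases j) (auto simp: bioriented_def all_bool_eq)
    obtain \<omega>' x i where \<omega>': "(\<omega>, \<omega>') \<in> orient_equiv 1 G" "bioriented \<omega>' = {x}"
      "half_end G (x, i) = half_end G (g, \<not> j)" "\<forall>k. half_end G (x, k) \<in> Z"
      and agree: "\<And>y k. y = f \<or> (\<exists>k. half_end G (y, k) \<notin> Z) \<Longrightarrow> (y, k) \<in> \<omega>' \<longleftrightarrow> (y, k) \<in> \<omega>"
      using Z g(4) unfolding good_def reach_def by blast
    \<comment> \<open>Because \<open>g\<close> has an end outside \<open>Z\<close>, its direction in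
      \<open>\<omega>'\<close> is the original one. So \<open>g\<close> can take over the
      biorientation from \<open>x\<close> at their common end in \<open>Z\<close>.\<close>
    have "(g, \<not> j) \<notin> \<omega>'" using agree g\<omega> g(3) by blast
    moreover have "\<omega>' \<in> orients 1 G" using \<omega>'(1) by (auto simp: orient_equiv_def)
    ultimately have sh: "bioriented (insert (g, \<not> j) (\<omega>' - {(x, i)})) = {g}"
      "(\<omega>', insert (g, \<not> j) (\<omega>' - {(x, i)})) \<in> orient_equiv 1 G"
      using shift_bioriented[OF wf _ \<omega>'(2) g(1)] \<omega>'(3) by auto
    let ?\<omega> = "insert (g, \<not> j) (\<omega>' - {(x, i)})" and ?Z = "insert (half_end G (g, j)) Z"
    have eq: "(\<omega>, ?\<omega>) \<in> orient_equiv 1 G"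
      using \<omega>'(1) sh(2) equiv_orient_equiv[of 1 G] by (meson equivE transE)
    have "g \<noteq> f" "x \<noteq> f" using contra eq sh(1) \<omega>' by auto
    moreover have "half_end G (g, k) \<in> ?Z" for k using g by (cases "k = j") auto
    \<comment> \<open>The shift alters only \<open>x\<close> and \<open>g\<close>; both lie inside
      \<open>?Z\<close> and neither is \<open>f\<close>.\<close>
    moreover have "(y, k) \<in> ?\<omega> \<longleftrightarrow> (y, k) \<in> \<omega>"
      if "y = f \<or> (\<exists>k. half_end G (y, k) \<notin> ?Z)" for y k
    proof -
      have "y = f \<or> (\<exists>k. half_end G (y, k) \<notin> Z)" using that by auto
      moreover have "y \<noteq> g" "y \<noteq> x" using that \<open>g \<noteq> f\<close> \<open>x \<noteq> f\<close> \<open>\<And>k. half_end G (g, k) \<in> ?Z\<close> \<omega>'(4) by auto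
      ultimately show ?thesis using agree[of y k] by auto
    qed
    ultimately have "reach ?Z (half_end G (g, j))"
      unfolding reach_def using eq sh(1)
      by (intro exI[of _ ?\<omega>] exI[of _ g] exI[of _ j]) auto
    \<comment> \<open>Enlarging \<open>Z\<close> only weakens the agreement clause, so the old
      witnesses remain valid.\<close>
    moreover have "reach ?Z v" if "v \<in> Z" for v
    proof -
      have "reach Z v" using Z that by (simp add: good_def)
      then obtain \<omega>'' y l where \<omega>'': "(\<omega>, \<omega>'') \<in> orient_equiv 1 G" "bioriented \<omega>'' = {y}"
        "half_end G (y, l) = v" "\<forall>k. half_end G (y, k) \<in> Z"
        "\<forall>y k. y = f \<or> (\<exists>k. half_end G (y, k) \<notin> Z) \<longrightarrow> ((y, k) \<in> \<omega>'' \<longleftrightarrow> (y, k) \<in> \<omega>)"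
        unfolding reach_def by (elim exE conjE) (rule that)
      have "\<forall>y k. y = f \<or> (\<exists>k. half_end G (y, k) \<notin> ?Z) \<longrightarrow> ((y, k) \<in> \<omega>'' \<longleftrightarrow> (y, k) \<in> \<omega>)"
        using \<omega>''(5) by blast
      with \<omega>''(1-4) show ?thesis
        unfolding reach_def by (intro exI[of _ \<omega>''] exI[of _ y] exI[of _ l]) simp
    qed
    ultimately have "good ?Z"
      using Z half_end_in_verts[OF wf g(1)] by (auto simp: good_def)
    then show False using max[of ?Z] g(3) by auto
  qed
  \<comment> \<open>Every vertex is reached now, in particular the end of \<open>f\<close> where
    \<open>f\<close> has no target. One further shift at that end biorients
    \<open>f\<close>.\<close>
  have "f \<notin> bioriented \<omega>" using contra refl e by auto
  then obtain j where j: "(f, j) \<notin> \<omega>" by (auto simp: bioriented_def)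
  have "reach Z (half_end G (f, j))"
    using Z \<open>Z = verts G\<close> half_end_in_verts[OF wf f] by (auto simp: good_def)
  then obtain \<omega>' x i where \<omega>': "(\<omega>, \<omega>') \<in> orient_equiv 1 G" "bioriented \<omega>' = {x}"
    "half_end G (x, i) = half_end G (f, j)" "(f, j) \<notin> \<omega>'"
    unfolding reach_def using j by blast
  have "\<omega>' \<in> orients 1 G" using \<omega>'(1) by (auto simp: orient_equiv_def)
  from shift_bioriented[OF wf this \<omega>'(2) f \<omega>'(4) \<omega>'(3)[symmetric]]
  show False using contra \<omega>'(1) equiv_orient_equiv[of 1 G] by (meson equivE transE)
qed

section \<open>Quotient maps\<close>

text \<open>More general than contractions, since \<open>(G / S\<^sub>0) - (S - S\<^sub>0)\<close> need not be a contraction of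
  \<open>G - S\<close>: vertices joined only by edges of \<open>S \<inter> S\<^sub>0\<close> are identified too.\<close>

definition quotient_map :: "('v \<Rightarrow> 'u) \<Rightarrow> ('v, 'e) mgraph \<Rightarrow> ('u, 'e) mgraph \<Rightarrow> bool" where
  "quotient_map f G K \<longleftrightarrow> f ` verts G = verts K \<and> edges K \<subseteq> edges G \<and>
     (\<forall>e\<in>edges K. \<forall>i. half_end K (e, i) = f (half_end G (e, i))) \<and>
     (\<forall>e\<in>edges G - edges K. \<forall>i j. f (half_end G (e, i)) = f (half_end G (e, j)))"

lemma quotient_mapD:
  assumes "quotient_map f G K"
  shows "f ` verts G = verts K" "edges K \<subseteq> edges G"
    "e \<in> edges K \<Longrightarrow> half_end K (e, i) = f (half_end G (e, i))"
    "e \<in> edges G \<Longrightarrow> e \<notin> edges K \<Longrightarrow> f (half_end G (e, i)) = f (half_end G (e, j))"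
  using assms unfolding quotient_map_def by blast+

lemma wf_graph_quotient:
  assumes "quotient_map f G K" "wf_graph G"
  shows "wf_graph K"
proof -
  have "finite (verts K)" "finite (edges K)"
    using quotient_mapD(1,2)[OF assms(1)] assms(2) unfolding wf_graph_def
    by (metis finite_imageI, metis finite_subset)
  moreover have "half_end K (e, i) \<in> verts K" if "e \<in> edges K" for e i
    using quotient_mapD[OF assms(1)] that half_end_in_verts[OF assms(2)] by (metis imageI subsetD)
  ultimately show ?thesis by (auto simp: wf_graph_def)
qed

text \<open>\<open>S\<close> and \<open>T\<close> have to agree on the edges of \<open>K\<close>
  only. On collapsed edges they may differ, as \<open>S\<close> and \<open>S - S0\<close> do for a
  contraction of \<open>S0\<close>.\<close>

lemma quotient_map_delete:
  assumes "quotient_map f G K" "edges K - T = edges K - S"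
  shows "quotient_map f (delete G S) (delete K T)"
proof -
  have "e \<notin> edges K" if "e \<in> edges G - S" "e \<notin> edges K - T" for e
    using that assms(2) by blast
  then show ?thesis
    using assms(2) quotient_mapD[OF assms(1)] unfolding quotient_map_def by auto
qed

lemma quotient_map_comp:
  assumes f: "quotient_map f G H" and g: "quotient_map g H K"
  shows "quotient_map (g \<circ> f) G K"
  unfolding quotient_map_def
proof (intro conjI ballI allI)
  show "(g \<circ> f) ` verts G = verts K"
    using quotient_mapD(1)[OF f] quotient_mapD(1)[OF g] by (metis image_comp)
  show "edges K \<subseteq> edges G"
    using quotient_mapD(2)[OF f] quotient_mapD(2)[OF g] by simp
  show "half_end K (e, i) = (g \<circ> f) (half_end G (e, i))" if "e \<in> edges K" for e i
    using that quotient_mapD(2,3)[OF g] quotient_mapD(3)[OF f, of e] by auto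
  show "(g \<circ> f) (half_end G (e, i)) = (g \<circ> f) (half_end G (e, j))" if "e \<in> edges G - edges K" for e i j
  proof (cases "e \<in> edges H")
    case True
    then show ?thesis
      using that quotient_mapD(4)[OF g, of e i j] quotient_mapD(3)[OF f True] by simp
  next
    case False
    then show ?thesis using that quotient_mapD(4)[OF f, of e i j] by simp
  qed
qed

lemma quotient_map_contract:
  assumes wf: "wf_graph G"
  shows "quotient_map (\<lambda>v. linked (delete G (edges G - S)) `` {v}) G (contract G S)"
  unfolding quotient_map_def
proof (intro conjI ballI allI)
  let ?K = "delete G (edges G - S)"
  show "(\<lambda>v. linked ?K `` {v}) ` verts G = verts (contract G S)"
    by (auto simp: contract_def Let_def components_def quotient_def)
  show "edges (contract G S) \<subseteq> edges G" by auto
  show "half_end (contract G S) (e, i) = linked ?K `` {half_end G (e, i)}" for e i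
    by (simp add: contract_def Let_def)
  show "linked ?K `` {half_end G (e, i)} = linked ?K `` {half_end G (e, j)}"
    if "e \<in> edges G - edges (contract G S)" for e i j
  proof -
    have "(half_end G (e, i), half_end G (e, j)) \<in> linked ?K"
      using linked_edge[OF wf_graph_delete[OF wf], of e "edges G - S" i j] that by simp
    then show ?thesis using equiv_class_eq[OF equiv_linked] by metis
  qed
qed

lemma linked_imp_eq:
  assumes "\<And>e i. e \<in> edges G \<Longrightarrow> f (half_end G (e, i)) = f (half_end G (e, \<not> i))" "(u, v) \<in> linked G"
  shows "f u = f v"
proof -
  have "(u, v) \<in> {(half_end G (e, i), half_end G (e, \<not> i)) | e i. e \<in> edges G}\<^sup>*"
    using assms(2) by (simp add: linked_def)
  then show ?thesis by (induction rule: rtrancl_induct) (use assms(1) in auto)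
qed

text \<open>The universal property of contractions. No edge of \<open>S\<close> survives in
  \<open>K\<close>, so \<open>f\<close> identifies the ends of each contracted edge and is constant
  on the components that become vertices.\<close>

lemma quotient_map_factor:
  assumes wf: "wf_graph G" and f: "quotient_map f G K" and S: "edges K \<subseteq> edges G - S"
  obtains g where "quotient_map g (contract G S) K"
proof
  let ?K = "delete G (edges G - S)"
  let ?c = "\<lambda>v. linked ?K `` {v}"
  \<comment> \<open>A vertex of the contraction is a set of vertices of \<open>G\<close>; any
    representative gives the same value.\<close>
  define g where "g X = f (SOME v. v \<in> X)" for X
  have c: "quotient_map ?c G (contract G S)" by (rule quotient_map_contract[OF wf])
  have gc: "g (?c v) = f v" if "v \<in> verts G" for v
  proof -
    have "v \<in> ?c v" using that by (simp add: linked_def)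
    then have "(v, SOME u. u \<in> ?c v) \<in> linked ?K" by (metis Image_singleton_iff someI)
    moreover have "f (half_end ?K (e, i)) = f (half_end ?K (e, \<not> i))" if "e \<in> edges ?K" for e i
    proof -
      have "e \<in> edges G" "e \<notin> edges K" using that S by auto
      then show ?thesis using quotient_mapD(4)[OF f] by simp
    qed
    ultimately show ?thesis using linked_imp_eq[of ?K f] unfolding g_def by metis
  qed
  show "quotient_map g (contract G S) K"
    unfolding quotient_map_def
  proof (intro conjI ballI allI)
    have "g ` ?c ` verts G = f ` verts G" unfolding image_image using gc by (intro image_cong) auto
    then show "g ` verts (contract G S) = verts K"
      using quotient_mapD(1)[OF c] quotient_mapD(1)[OF f] by simp
    show "edges K \<subseteq> edges (contract G S)" using S by simp
    show "half_end K (e, i) = g (half_end (contract G S) (e, i))" if "e \<in> edges K" for e i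
    proof -
      have "e \<in> edges (contract G S)" "e \<in> edges G" using that S by auto
      then show ?thesis
        using quotient_mapD(3)[OF c] quotient_mapD(3)[OF f that] gc half_end_in_verts[OF wf] by simp
    qed
    show "g (half_end (contract G S) (e, i)) = g (half_end (contract G S) (e, j))"
      if "e \<in> edges (contract G S) - edges K" for e i j
    proof -
      have "e \<in> edges (contract G S)" "e \<in> edges G" "e \<notin> edges K" using that by auto
      then show ?thesis
        using quotient_mapD(3)[OF c] quotient_mapD(4)[OF f, of e i j] gc half_end_in_verts[OF wf] by simp
    qed
  qed
qed

section \<open>Transport of cuts, connectedness and orientations along a quotient map\<close>

locale graph_quotient =
  fixes f :: "'v \<Rightarrow> 'u" and G :: "('v, 'e) mgraph" and K :: "('u, 'e) mgraph"
  assumes wf: "wf_graph G" and quot: "quotient_map f G K"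
begin

definition pull :: "'u set \<Rightarrow> 'v set" where
  "pull Z = {v \<in> verts G. f v \<in> Z}"

lemmas quot_simps = quotient_mapD[OF quot]

lemma edges_subset: "e \<in> edges K \<Longrightarrow> e \<in> edges G"
  using quot_simps(2) by auto

lemma wf_K: "wf_graph K"
  using wf_graph_quotient[OF quot wf] .

lemma pull_Diff: "verts G - pull Z = pull (verts K - Z)"
  using quot_simps(1) by (auto simp: pull_def)

lemma pull_proper:
  assumes "Z \<subset> verts K"
  shows "pull Z \<subset> verts G"
proof -
  obtain u where u: "u \<in> verts K" "u \<notin> Z" using assms by blast
  from u(1) obtain v where "v \<in> verts G" "u = f v" unfolding quot_simps(1)[symmetric] by (rule imageE)
  with u(2) have "v \<in> verts G" "v \<notin> pull Z" by (simp_all add: pull_def)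
  moreover have "pull Z \<subseteq> verts G" by (auto simp: pull_def)
  ultimately show ?thesis by blast
qed

lemma pull_nonempty:
  assumes "Z \<subseteq> verts K" "Z \<noteq> {}"
  shows "pull Z \<noteq> {}"
proof -
  obtain u where u: "u \<in> verts K" "u \<in> Z" using assms by blast
  from u(1) obtain v where "v \<in> verts G" "u = f v" unfolding quot_simps(1)[symmetric] by (rule imageE)
  with u(2) have "v \<in> pull Z" by (simp add: pull_def)
  then show ?thesis by blast
qed

lemma half_end_in_pull: "e \<in> edges G \<Longrightarrow> half_end G (e, i) \<in> pull Z \<longleftrightarrow> f (half_end G (e, i)) \<in> Z"
  using half_end_in_verts[OF wf] by (simp add: pull_def)

text \<open>An edge of \<open>G\<close> missing from \<open>K\<close> has its ends identified by
  \<open>f\<close>, so it cannot join the preimage of \<open>Z\<close> to its complement.\<close>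

lemma cut_pull: "cut G (pull Z) = cut K Z"
proof (intro set_eqI iffI)
  fix e assume "e \<in> cut G (pull Z)"
  then obtain i where e: "e \<in> edges G" "f (half_end G (e, i)) \<in> Z"
    "f (half_end G (e, \<not> i)) \<in> verts K - Z"
    unfolding cut_def pull_Diff by (auto simp: half_end_in_pull)
  have eK: "e \<in> edges K"
  proof (rule ccontr)
    assume "e \<notin> edges K"
    with e show False using quot_simps(4)[of e i "\<not> i"] by auto
  qed
  then show "e \<in> cut K Z" using e quot_simps(3)[OF eK] unfolding cut_def by auto
next
  fix e assume "e \<in> cut K Z"
  then show "e \<in> cut G (pull Z)"
    unfolding cut_def pull_Diff by (auto simp: half_end_in_pull edges_subset quot_simps(3))
qed

lemma has_target_in_pull:
  assumes "e \<in> edges K"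
  shows "has_target_in K (restrict_orientation \<omega> K) e Z \<longleftrightarrow> has_target_in G \<omega> e (pull Z)"
  using assms edges_subset[OF assms] quot_simps(3)[OF assms]
  by (auto simp: has_target_in_def restrict_orientation_def half_end_in_pull)

lemma not_bridge_quotient:
  assumes "\<forall>e. \<not> bridge G e"
  shows "\<not> bridge K e"
proof
  assume "bridge K e"
  then obtain Z where Z: "Z \<noteq> {}" "Z \<subset> verts K" "cut K Z = {e}" by (auto simp: bridge_def)
  then have "pull Z \<noteq> {}" "pull Z \<subset> verts G" "cut G (pull Z) = {e}"
    using pull_nonempty[of Z] pull_proper[of Z] cut_pull[of Z] by auto
  then have "bridge G e" unfolding bridge_def by (intro exI[of _ "pull Z"] conjI)
  then show False using assms by simp
qed

text \<open>Along a path, an edge of \<open>K\<close> maps to itself and any other edge collapses to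
  a vertex.\<close>

lemma linked_quotient:
  assumes "(u, v) \<in> linked G"
  shows "(f u, f v) \<in> linked K"
proof -
  have "(u, v) \<in> {(half_end G (e, i), half_end G (e, \<not> i)) | e i. e \<in> edges G}\<^sup>*"
    using assms by (simp add: linked_def)
  then have "(f u, f v) \<in> {(half_end K (e, i), half_end K (e, \<not> i)) | e i. e \<in> edges K}\<^sup>*" (is "_ \<in> ?r\<^sup>*")
  proof (induction rule: rtrancl_induct)
    case (step x y)
    then obtain e i where e: "e \<in> edges G" "x = half_end G (e, i)" "y = half_end G (e, \<not> i)" by blast
    show ?case
    proof (cases "e \<in> edges K")
      case True
      then have "f x = half_end K (e, i) \<and> f y = half_end K (e, \<not> i) \<and> e \<in> edges K"
        using e quot_simps(3)[OF True] by simp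
      then have "(f x, f y) \<in> ?r" by blast
      then show ?thesis using step.IH by (rule rtrancl_into_rtrancl[rotated])
    next
      case False
      then have "f x = f y" using e quot_simps(4)[of e i "\<not> i"] by simp
      then show ?thesis using step.IH by simp
    qed
  qed simp
  moreover have "f u \<in> verts K" "f v \<in> verts K"
    using assms quot_simps(1) by (auto simp: linked_def)
  ultimately show ?thesis by (simp add: linked_def)
qed

lemma connected_quotient:
  assumes "connected_graph G"
  shows "connected_graph K"
proof -
  have "verts K \<noteq> {}" using assms quot_simps(1) by (auto simp: connected_graph_iff)
  moreover have "(x, y) \<in> linked K" if "x \<in> verts K" "y \<in> verts K" for x y
  proof -
    have "x \<in> f ` verts G" "y \<in> f ` verts G" using that quot_simps(1) by simp_all
    then show ?thesis using assms linked_quotient by (auto simp: connected_graph_iff)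
  qed
  ultimately show ?thesis by (auto simp: connected_graph_iff)
qed

lemma gen_orientation_quotient:
  "gen_orientation G \<omega> \<Longrightarrow> gen_orientation K (restrict_orientation \<omega> K)"
  using edges_subset by (auto simp: gen_orientation_def restrict_orientation_def)

lemma bioriented_restrict:
  "bioriented (restrict_orientation \<omega> K) = bioriented \<omega> \<inter> edges K"
  by (auto simp: bioriented_def restrict_orientation_def)

lemma totally_cyclic_quotient:
  assumes "totally_cyclic G \<omega>"
  shows "totally_cyclic K (restrict_orientation \<omega> K)"
  unfolding totally_cyclic_def
proof (intro allI impI)
  fix Z assume Z: "Z \<noteq> {} \<and> Z \<subset> verts K \<and> cut K Z \<noteq> {}"
  then have "pull Z \<noteq> {} \<and> pull Z \<subset> verts G \<and> cut G (pull Z) \<noteq> {}"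
    using pull_nonempty[of Z] pull_proper[of Z] cut_pull[of Z] by auto
  then have "(\<exists>e\<in>cut K Z. has_target_in G \<omega> e (pull Z)) \<and>
      (\<exists>e\<in>cut K Z. has_target_in G \<omega> e (pull (verts K - Z)))"
    using spec[OF assms[unfolded totally_cyclic_def], of "pull Z"] by (simp add: cut_pull pull_Diff)
  moreover have "e \<in> edges K" if "e \<in> cut K Z" for e using that by (simp add: cut_def)
  ultimately show "(\<exists>e\<in>cut K Z. has_target_in K (restrict_orientation \<omega> K) e Z) \<and>
      (\<exists>e\<in>cut K Z. has_target_in K (restrict_orientation \<omega> K) e (verts K - Z))"
    using has_target_in_pull by blast
qed

lemma rooted_at_quotient:
  assumes "rooted_at G \<omega> e" "e \<in> edges K"
  shows "rooted_at K (restrict_orientation \<omega> K) e"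
  unfolding rooted_at_def
proof (intro allI impI)
  fix Z assume Z: "Z \<subset> verts K \<and> e \<in> edges (induced K Z)"
  then have "pull Z \<subset> verts G" "e \<in> edges (induced G (pull Z))"
    using assms(2) edges_subset[OF assms(2)] pull_proper quot_simps(3)
    by (auto simp: induced_def half_end_in_pull)
  then obtain e' where "e' \<in> cut K Z" "has_target_in G \<omega> e' (pull (verts K - Z))"
    using spec[OF assms(1)[unfolded rooted_at_def], of "pull Z"] by (auto simp: cut_pull pull_Diff)
  moreover from this have "e' \<in> edges K" by (simp add: cut_def)
  ultimately show "\<exists>e'\<in>cut K Z. has_target_in K (restrict_orientation \<omega> K) e' (verts K - Z)"
    using has_target_in_pull by blast
qed

text \<open>Ensures that the restriction is again an orientation of the same kind. For
  \<open>b = 1\<close>, either the bioriented edge survives, or no edge does; then connectedness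
  makes \<open>K\<close> a single vertex, where the empty orientation counts as rooted.\<close>

definition admissible :: "nat \<Rightarrow> 'e orientation \<Rightarrow> bool" where
  "admissible b \<omega> \<longleftrightarrow> b = 0 \<or>
    b = 1 \<and> connected_graph G \<and> (bioriented \<omega> \<subseteq> edges K \<or> edges K = {})"

lemma orients_quotient:
  assumes "\<omega> \<in> orients b G" "admissible b \<omega>"
  shows "restrict_orientation \<omega> K \<in> orients b K"
proof (cases "b = 0")
  case True
  then show ?thesis
    using assms(1) gen_orientation_quotient totally_cyclic_quotient
    by (auto simp: orients_0_iff[OF wf] orients_0_iff[OF wf_K] bioriented_restrict)
next
  case False
  then have b: "b = 1" "connected_graph G" "bioriented \<omega> \<subseteq> edges K \<or> edges K = {}"
    using assms(2) by (auto simp: admissible_def)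
  show ?thesis
  proof (cases "edges K = {}")
    case True
    then show ?thesis
      using orients_1_no_edges[OF connected_quotient[OF b(2)]] b(1)
      by (simp add: restrict_orientation_def)
  next
    case False
    then have ne: "edges G \<noteq> {}" using edges_subset by blast
    obtain e where "bioriented \<omega> = {e}" "rooted_at G \<omega> e" "gen_orientation G \<omega>"
      using assms(1) b(1) orients_1_iff[OF ne] by blast
    moreover from this have "e \<in> edges K" using b False by auto
    ultimately show ?thesis
      using b(1) orients_1_iff[OF False] gen_orientation_quotient rooted_at_quotient
      by (auto simp: bioriented_restrict)
  qed
qed

text \<open>A contracted edge that is not bioriented contributes exactly one target to its image vertex,
  whatever its direction.\<close>

lemma card_targets_quotient:
  assumes gen: "gen_orientation G \<omega>" and bi: "bioriented \<omega> \<subseteq> edges K"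
  shows "(\<Sum>v\<in>pull {u}. card {h \<in> \<omega>. half_end G h = v}) =
    card {h \<in> restrict_orientation \<omega> K. half_end K h = u} +
    card {e \<in> edges G - edges K. f (half_end G (e, True)) = u}"
proof -
  let ?A = "{h \<in> restrict_orientation \<omega> K. half_end K h = u}"
  let ?B = "{h \<in> \<omega>. fst h \<in> edges G - edges K \<and> f (half_end G h) = u}"
  have sub: "\<omega> \<subseteq> edges G \<times> UNIV" using gen by (simp add: gen_orientation_def)
  have fin: "finite \<omega>" by (rule finite_orientation[OF wf gen])
  have finA: "finite ?A" using fin by (simp add: restrict_orientation_def)
  have "(\<Sum>v\<in>pull {u}. card {h \<in> \<omega>. half_end G h = v}) =
      card (\<Union>v\<in>pull {u}. {h \<in> \<omega>. half_end G h = v})"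
    using wf fin by (subst card_UN_disjoint) (auto simp: pull_def wf_graph_def)
  also have "(\<Union>v\<in>pull {u}. {h \<in> \<omega>. half_end G h = v}) = ?A \<union> ?B"
  proof (intro set_eqI iffI)
    fix h assume "h \<in> (\<Union>v\<in>pull {u}. {h \<in> \<omega>. half_end G h = v})"
    then have h: "h \<in> \<omega>" "f (half_end G h) = u" by (auto simp: pull_def)
    then have "fst h \<in> edges G" using sub by auto
    then show "h \<in> ?A \<union> ?B"
      using h quot_simps(3)[of "fst h" "snd h"]
      by (cases h; cases "fst h \<in> edges K") (auto simp: restrict_orientation_def)
  next
    fix h assume "h \<in> ?A \<union> ?B"
    then have h: "h \<in> \<omega>" "f (half_end G h) = u"
      using quot_simps(3)[of "fst h" "snd h"] by (auto simp: restrict_orientation_def)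
    then have "half_end G h \<in> verts G" using sub half_end_in_verts[OF wf] by (cases h) auto
    then show "h \<in> (\<Union>v\<in>pull {u}. {h \<in> \<omega>. half_end G h = v})" using h by (simp add: pull_def)
  qed
  also have "card (?A \<union> ?B) = card ?A + card ?B"
    using fin finA by (intro card_Un_disjoint) (auto simp: restrict_orientation_def)
  \<comment> \<open>Projecting targets to their edges is injective, as no contracted edge is
    bioriented, and surjective, as each edge has a target. Both ends of a contracted edge have the
    same image, so testing the half-edge \<open>True\<close> is an arbitrary choice.\<close>
  also have "card ?B = card {e \<in> edges G - edges K. f (half_end G (e, True)) = u}"
  proof (rule bij_betw_same_card[of fst])
    have "inj_on fst ?B"
    proof (rule inj_onI)
      fix g h assume gh: "g \<in> ?B" "h \<in> ?B" "fst g = fst h"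
      show "g = h"
      proof (rule ccontr)
        assume "g \<noteq> h"
        then have "snd h = (\<not> snd g)" using gh(3) by (auto simp: prod_eq_iff)
        then have "(fst g, snd g) \<in> \<omega>" "(fst g, \<not> snd g) \<in> \<omega>"
          using gh by (cases g; cases h; auto)+
        then have "fst g \<in> bioriented \<omega>"
          by (cases "snd g") (auto simp: bioriented_def all_bool_eq)
        then show False using gh(1) bi by auto
      qed
    qed
    moreover have "fst ` ?B = {e \<in> edges G - edges K. f (half_end G (e, True)) = u}"
    proof (intro set_eqI iffI)
      fix e assume "e \<in> fst ` ?B"
      then obtain i where "e \<in> edges G" "e \<notin> edges K" "f (half_end G (e, i)) = u" by auto
      then show "e \<in> {e \<in> edges G - edges K. f (half_end G (e, True)) = u}"
        using quot_simps(4)[of e i True] by simp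
    next
      fix e assume e: "e \<in> {e \<in> edges G - edges K. f (half_end G (e, True)) = u}"
      then obtain i where "(e, i) \<in> \<omega>" using gen by (auto simp: gen_orientation_def)
      then have "(e, i) \<in> ?B" using e quot_simps(4)[of e i True] by simp
      then show "e \<in> fst ` ?B" by force
    qed
    ultimately show "bij_betw fst ?B {e \<in> edges G - edges K. f (half_end G (e, True)) = u}"
      by (simp add: bij_betw_def)
  qed
  finally show ?thesis .
qed

text \<open>Target counts are summed over the fibre of each vertex \<open>u\<close>. By
  \<open>card_targets_quotient\<close> the sum exceeds the count in \<open>K\<close> by a number
  independent of the orientation, which cancels.\<close>

lemma orient_equiv_quotient:
  assumes eq: "(\<omega>, \<omega>') \<in> orient_equiv b G" and adm: "admissible b \<omega>" "admissible b \<omega>'"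
  shows "(restrict_orientation \<omega> K, restrict_orientation \<omega>' K) \<in> orient_equiv b K"
proof -
  have \<omega>: "\<omega> \<in> orients b G" "\<omega>' \<in> orients b G" using eq by (auto simp: orient_equiv_def)
  then have mem: "restrict_orientation \<omega> K \<in> orients b K" "restrict_orientation \<omega>' K \<in> orients b K"
    using adm orients_quotient by auto
  show ?thesis
  proof (cases "edges K = {}")
    case True
    then show ?thesis using mem by (auto simp: orient_equiv_def orient_div_def)
  next
    case False
    then have ne: "edges G \<noteq> {}" using edges_subset by blast
    have bi: "bioriented \<omega> \<subseteq> edges K" "bioriented \<omega>' \<subseteq> edges K"
      using adm \<omega> False by (auto simp: admissible_def orients_0_iff[OF wf])
    have gen: "gen_orientation G \<omega>" "gen_orientation G \<omega>'"
      using \<omega> gen_orientation_if_orients by auto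
    have "card {h \<in> restrict_orientation \<omega> K. half_end K h = u} =
        card {h \<in> restrict_orientation \<omega>' K. half_end K h = u}" for u
    proof -
      have "(\<Sum>v\<in>pull {u}. card {h \<in> \<omega>. half_end G h = v}) =
          (\<Sum>v\<in>pull {u}. card {h \<in> \<omega>'. half_end G h = v})"
        using eq unfolding orient_equiv_iff[OF ne] by (intro sum.cong) (auto simp: pull_def)
      then show ?thesis
        using card_targets_quotient[OF gen(1) bi(1)] card_targets_quotient[OF gen(2) bi(2)] by simp
    qed
    then show ?thesis using mem orient_equiv_iff[OF False] by blast
  qed
qed

lemma adm_sets_quotient:
  assumes "S \<in> adm_sets b G"
  shows "S \<inter> edges K \<in> adm_sets b K"
proof -
  interpret D: graph_quotient f "delete G S" "delete K (S \<inter> edges K)"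
    by unfold_locales (rule wf_graph_delete[OF wf], rule quotient_map_delete[OF quot], blast)
  show ?thesis
    using assms D.not_bridge_quotient D.connected_quotient by (auto simp: adm_sets_def)
qed

end

section \<open>Push-forward of classes\<close>

lemma orient_class_eq:
  "(\<omega>, \<omega>') \<in> orient_equiv b G \<Longrightarrow> orient_class b G \<omega> = orient_class b G \<omega>'"
  by (rule equiv_class_eq[OF equiv_orient_equiv])

lemma self_in_orient_class: "\<omega> \<in> orients b G \<Longrightarrow> \<omega> \<in> orient_class b G \<omega>"
  by (rule equiv_class_self[OF equiv_orient_equiv])

text \<open>For \<open>b = 1\<close> the biorientation is moved to an edge outside
  \<open>S0\<close>, if \<open>G - S\<close> has one.\<close>

lemma exists_pushable:
  assumes wf: "wf_graph G" and b: "b \<in> {0, 1}" and \<omega>: "\<omega> \<in> orients b (delete G S)"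
  obtains \<omega>' where "(\<omega>, \<omega>') \<in> orient_equiv b (delete G S)" "pushable G S0 S \<omega>'"
proof (cases "b = 0 \<or> edges (delete G S) \<subseteq> S0")
  case True
  then have "pushable G S0 S \<omega>"
    using \<omega> orients_0_iff[OF wf_graph_delete[OF wf]] by (auto simp: pushable_def)
  then show ?thesis using that[of \<omega>] self_in_orient_class[OF \<omega>] by simp
next
  case False
  then obtain e where e: "e \<in> edges (delete G S)" "e \<notin> S0" by blast
  have b1: "b = 1" using False b by auto
  obtain \<omega>' where "(\<omega>, \<omega>') \<in> orient_equiv 1 (delete G S)" "bioriented \<omega>' = {e}"
    using exists_equiv_bioriented_at[OF wf_graph_delete[OF wf] \<omega>[unfolded b1] e(1)] by blast
  then show ?thesis using that[of \<omega>'] e(2) b1 by (simp add: pushable_def)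
qed

lemma OP_cases:
  assumes "wf_graph G" "b \<in> {0, 1}" "x \<in> OP b G"
  obtains S \<omega> where "S \<in> adm_sets b G" "\<omega> \<in> orients b (delete G S)" "pushable G S0 S \<omega>"
    "x = (S, orient_class b (delete G S) \<omega>)"
proof -
  obtain S \<omega> where S: "S \<in> adm_sets b G" "\<omega> \<in> orients b (delete G S)"
    "x = (S, orient_class b (delete G S) \<omega>)"
    using assms(3) by (auto simp: OP_def elim!: quotientE)
  obtain \<omega>' where \<omega>': "(\<omega>, \<omega>') \<in> orient_equiv b (delete G S)" "pushable G S0 S \<omega>'"
    using exists_pushable[OF assms(1,2) S(2)] .
  then have "\<omega>' \<in> orients b (delete G S)" by (simp add: orient_equiv_def)
  then show ?thesis using that S \<omega>' orient_class_eq[OF \<omega>'(1)] by metis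
qed

text \<open>\<open>S\<close> and \<open>S - S0\<close> delete the same edges from the
  contraction.\<close>

lemma push_quotient:
  assumes "wf_graph G"
  obtains f where "graph_quotient f (delete G S) (delete (contract G S0) (S - S0))"
proof -
  have "edges (contract G S0) - (S - S0) = edges (contract G S0) - S" by auto
  then show ?thesis
    using that wf_graph_delete[OF assms] quotient_map_delete[OF quotient_map_contract[OF assms]]
    unfolding graph_quotient_def by blast
qed

lemma push_admissible:
  assumes "wf_graph G" "b \<in> {0, 1}" "S \<in> adm_sets b G" "\<omega> \<in> orients b (delete G S)"
    "pushable G S0 S \<omega>"
  shows "graph_quotient.admissible (delete G S) (delete (contract G S0) (S - S0)) b \<omega>"
proof -
  obtain f where "graph_quotient f (delete G S) (delete (contract G S0) (S - S0))"
    using push_quotient[OF assms(1)] .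
  then interpret graph_quotient f "delete G S" "delete (contract G S0) (S - S0)" .
  have "bioriented \<omega> \<subseteq> edges G - S"
    using bioriented_subset_edges[OF gen_orientation_if_orients[OF assms(4)]] by simp
  then show ?thesis
    using assms(2,3,5) unfolding admissible_def pushable_def adm_sets_def by auto
qed

text \<open>This gives the independence of the push-forward from the representative.\<close>

lemma push_orient_equiv:
  assumes wf: "wf_graph G" and b: "b \<in> {0, 1}" and S: "S \<in> adm_sets b G"
    and eq: "(\<omega>, \<omega>') \<in> orient_equiv b (delete G S)"
    and p: "pushable G S0 S \<omega>" "pushable G S0 S \<omega>'"
  shows "(push_orient G S0 S \<omega>, push_orient G S0 S \<omega>') \<in> orient_equiv b (delete (contract G S0) (S - S0))"
proof -
  obtain f where "graph_quotient f (delete G S) (delete (contract G S0) (S - S0))"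
    using push_quotient[OF wf] .
  then interpret graph_quotient f "delete G S" "delete (contract G S0) (S - S0)" .
  have "\<omega> \<in> orients b (delete G S)" "\<omega>' \<in> orients b (delete G S)"
    using eq by (auto simp: orient_equiv_def)
  then show ?thesis
    using orient_equiv_quotient[OF eq] push_admissible[OF assms(1) b S] p by (simp add: push_orient_def)
qed

text \<open>The diagonal case of \<open>push_orient_equiv\<close>: equivalence includes
  membership.\<close>

lemma push_orients:
  assumes "wf_graph G" "b \<in> {0, 1}" "S \<in> adm_sets b G" "\<omega> \<in> orients b (delete G S)"
    "pushable G S0 S \<omega>"
  shows "push_orient G S0 S \<omega> \<in> orients b (delete (contract G S0) (S - S0))"
  using push_orient_equiv[OF assms(1-3) _ assms(5,5)] self_in_orient_class[OF assms(4)]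
  by (simp add: orient_equiv_def)

lemma push_adm_sets:
  assumes wf: "wf_graph G" and S: "S \<in> adm_sets b G"
  shows "S - S0 \<in> adm_sets b (contract G S0)"
proof -
  interpret graph_quotient "\<lambda>v. linked (delete G (edges G - S0)) `` {v}" G "contract G S0"
    by unfold_locales (rule wf, rule quotient_map_contract[OF wf])
  have "S \<inter> edges (contract G S0) = S - S0" using S by (auto simp: adm_sets_def)
  then show ?thesis using adm_sets_quotient[OF S] by simp
qed

text \<open>By \<open>push_orient_equiv\<close> all classes in the union defining
  \<open>push_class\<close> coincide, and \<open>\<omega>'\<close> shows that the union is not
  empty.\<close>

lemma push_class_eq:
  assumes wf: "wf_graph G" and b: "b \<in> {0, 1}" and S: "S \<in> adm_sets b G"
    and eq: "(\<omega>', \<omega>) \<in> orient_equiv b (delete G S)" and p: "pushable G S0 S \<omega>'"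
  shows "push_class b G S0 (S, orient_class b (delete G S) \<omega>) =
    (S - S0, orient_class b (delete (contract G S0) (S - S0)) (push_orient G S0 S \<omega>'))"
proof -
  let ?A = "{\<omega>1 \<in> orient_class b (delete G S) \<omega>. pushable G S0 S \<omega>1}"
  have C: "orient_class b (delete G S) \<omega> = orient_class b (delete G S) \<omega>'"
    using orient_class_eq[OF eq] by simp
  have "\<omega>' \<in> orients b (delete G S)" using eq by (simp add: orient_equiv_def)
  then have "\<omega>' \<in> ?A" unfolding C using p self_in_orient_class by blast
  moreover have "orient_class b (delete (contract G S0) (S - S0)) (push_orient G S0 S \<omega>1) =
      orient_class b (delete (contract G S0) (S - S0)) (push_orient G S0 S \<omega>')" if "\<omega>1 \<in> ?A" for \<omega>1
  proof -
    have "(\<omega>', \<omega>1) \<in> orient_equiv b (delete G S)" "pushable G S0 S \<omega>1"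
      using that unfolding C by auto
    from orient_class_eq[OF push_orient_equiv[OF wf b S this(1) p this(2)]] show ?thesis by simp
  qed
  ultimately have "(\<Union>\<omega>1\<in>?A. orient_class b (delete (contract G S0) (S - S0)) (push_orient G S0 S \<omega>1)) =
      orient_class b (delete (contract G S0) (S - S0)) (push_orient G S0 S \<omega>')"
    by (intro UN_constant_eq[of \<omega>']) blast+
  then show ?thesis by simp
qed

lemma push_class_eq_self:
  assumes "wf_graph G" "b \<in> {0, 1}" "S \<in> adm_sets b G" "\<omega> \<in> orients b (delete G S)"
    "pushable G S0 S \<omega>"
  shows "push_class b G S0 (S, orient_class b (delete G S) \<omega>) =
    (S - S0, orient_class b (delete (contract G S0) (S - S0)) (push_orient G S0 S \<omega>))"
  using push_class_eq[OF assms(1-3) _ assms(5)] self_in_orient_class[OF assms(4)] by simp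

lemma push_class_in_OP:
  assumes "wf_graph G" "b \<in> {0, 1}" "x \<in> OP b G"
  shows "push_class b G S0 x \<in> OP b (contract G S0)"
proof -
  obtain S \<omega> where S: "S \<in> adm_sets b G" "\<omega> \<in> orients b (delete G S)" "pushable G S0 S \<omega>"
    "x = (S, orient_class b (delete G S) \<omega>)"
    using OP_cases[OF assms] .
  show ?thesis
    using push_class_eq_self[OF assms(1,2) S(1-3)] push_orients[OF assms(1,2) S(1-3)]
      push_adm_sets[OF assms(1) S(1)] S(4)
    by (auto simp: OP_def intro: quotientI)
qed

text \<open>Rootedness passes from a spanning subgraph to the whole graph, so on \<open>G - S\<close> one may replace
  an orientation by an equivalent one.\<close>

lemma replace_on_subgraph:
  assumes wf: "wf_graph G" and \<omega>: "\<omega> \<in> orients 1 G" and ne: "edges (delete G S) \<noteq> {}"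
    and eq: "(restrict_orientation \<omega> (delete G S), \<omega>2) \<in> orient_equiv 1 (delete G S)"
  obtains \<omega>' where "(\<omega>, \<omega>') \<in> orient_equiv 1 G" "restrict_orientation \<omega>' (delete G S) = \<omega>2"
    "bioriented \<omega>' = bioriented \<omega>2"
proof -
  let ?K = "delete G S"
  let ?W = "edges ?K \<times> (UNIV :: bool set)"
  let ?\<omega>1 = "restrict_orientation \<omega> ?K"
  define \<omega>' where "\<omega>' = (\<omega> - ?W) \<union> \<omega>2"
  have neG: "edges G \<noteq> {}" using ne by auto
  have \<omega>12: "?\<omega>1 \<in> orients 1 ?K" "\<omega>2 \<in> orients 1 ?K" using eq by (auto simp: orient_equiv_def)
  have gen: "gen_orientation G \<omega>" by (rule gen_orientation_if_orients[OF \<omega>])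
  obtain e0 where e0: "bioriented \<omega> = {e0}" using \<omega> orients_1_iff[OF neG] by auto
  obtain e1 where e1: "bioriented ?\<omega>1 = {e1}" using \<omega>12(1) orients_1_iff[OF ne] by auto
  obtain e2 where e2: "bioriented \<omega>2 = {e2}" "rooted_at ?K \<omega>2 e2" "gen_orientation ?K \<omega>2"
    using \<omega>12(2) orients_1_iff[OF ne] by auto
  have sub: "\<omega>2 \<subseteq> ?W" using e2(3) by (simp add: gen_orientation_def)
  \<comment> \<open>The restriction already contains a bioriented edge, so that of \<omega> lies in
    \<open>G - S\<close> and none is left outside after the replacement.\<close>
  have "e1 \<in> bioriented ?\<omega>1" using e1 by simp
  then have "e1 \<in> bioriented \<omega>" "e1 \<in> edges ?K" by (auto simp: bioriented_def restrict_orientation_def)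
  then have e0K: "e0 \<in> edges ?K" using e0 by simp
  have bi: "bioriented \<omega>' = bioriented \<omega>2"
  proof (intro set_eqI iffI)
    fix x assume x: "x \<in> bioriented \<omega>'"
    show "x \<in> bioriented \<omega>2"
    proof (cases "x \<in> edges ?K")
      case True
      then show ?thesis using x by (auto simp: bioriented_def \<omega>'_def)
    next
      case False
      then have "x \<in> bioriented \<omega>" using x sub by (auto simp: bioriented_def \<omega>'_def)
      then show ?thesis using False e0K e0 by auto
    qed
  qed (auto simp: bioriented_def \<omega>'_def)
  have res: "restrict_orientation \<omega>' ?K = \<omega>2"
    using sub by (auto simp: restrict_orientation_def \<omega>'_def)
  have e2K: "e2 \<in> edges ?K" "e2 \<in> edges G"
    using bioriented_subset_edges[OF e2(3)] e2(1) by auto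
  have "gen_orientation G \<omega>'"
    unfolding gen_orientation_def
  proof (intro conjI ballI)
    show "\<omega>' \<subseteq> edges G \<times> UNIV" using gen sub by (auto simp: gen_orientation_def \<omega>'_def)
    show "\<exists>i. (x, i) \<in> \<omega>'" if "x \<in> edges G" for x
      using gen e2(3) that by (cases "x \<in> edges ?K") (auto simp: gen_orientation_def \<omega>'_def)
  qed
  moreover have "rooted_at G \<omega>' e2"
    unfolding rooted_at_iff[OF wf e2K(2)]
  proof (intro allI impI)
    fix Z assume "Z \<subset> verts G \<and> (\<forall>i. half_end G (e2, i) \<in> Z)"
    then obtain x i where "x \<in> edges ?K" "(x, i) \<in> \<omega>2" "half_end G (x, i) \<notin> Z" "half_end G (x, \<not> i) \<in> Z"
      using spec[OF e2(2)[unfolded rooted_at_iff[OF wf_graph_delete[OF wf] e2K(1)]], of Z] by auto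
    then show "\<exists>x\<in>edges G. \<exists>i. (x, i) \<in> \<omega>' \<and> half_end G (x, i) \<notin> Z \<and> half_end G (x, \<not> i) \<in> Z"
      by (auto simp: \<omega>'_def)
  qed
  ultimately have "\<omega>' \<in> orients 1 G" using e2(1) bi orients_1_iff[OF neG] by auto
  moreover have "card {h \<in> \<omega>. half_end G h = v} = card {h \<in> \<omega>'. half_end G h = v}"
    if "v \<in> verts G" for v
  proof -
    let ?X = "{h \<in> \<omega> - ?W. half_end G h = v}"
    have fin: "finite \<omega>" "finite \<omega>2"
      using finite_orientation[OF wf gen] finite_orientation[OF wf_graph_delete[OF wf] e2(3)] by auto
    have "{h \<in> \<omega>. half_end G h = v} = ?X \<union> {h \<in> ?\<omega>1. half_end G h = v}"
      by (auto simp: restrict_orientation_def)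
    moreover have "card (?X \<union> {h \<in> ?\<omega>1. half_end G h = v}) = card ?X + card {h \<in> ?\<omega>1. half_end G h = v}"
      using fin by (intro card_Un_disjoint) (auto simp: restrict_orientation_def)
    moreover have "card {h \<in> ?\<omega>1. half_end G h = v} = card {h \<in> \<omega>2. half_end G h = v}"
      using eq that unfolding orient_equiv_iff[OF ne] by simp
    moreover have "card (?X \<union> {h \<in> \<omega>2. half_end G h = v}) = card ?X + card {h \<in> \<omega>2. half_end G h = v}"
      using fin sub by (intro card_Un_disjoint) auto
    moreover have "{h \<in> \<omega>'. half_end G h = v} = ?X \<union> {h \<in> \<omega>2. half_end G h = v}"
      by (auto simp: \<omega>'_def)
    ultimately show ?thesis by simp
  qed
  ultimately have "(\<omega>, \<omega>') \<in> orient_equiv 1 G" using \<omega> unfolding orient_equiv_iff[OF neG] by simp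
  then show ?thesis using that res bi by blast
qed

text \<open>For \<open>b = 1\<close> a pushable representative is chosen on \<open>G - S\<close>
  first and then extended to \<open>G - T\<close> by \<open>replace_on_subgraph\<close>. The
  bioriented edge is the same on both, so the extension is pushable too.\<close>

lemma exists_compatible_pushable:
  assumes wf: "wf_graph G" and b: "b \<in> {0, 1}" and TS: "T \<subseteq> S"
    and \<omega>S: "\<omega>S \<in> orients b (delete G S)" and \<omega>T: "\<omega>T \<in> orients b (delete G T)"
    and res: "restrict_orientation \<omega>T (delete G S) = \<omega>S"
  obtains \<omega>S' \<omega>T' where "(\<omega>S, \<omega>S') \<in> orient_equiv b (delete G S)" "pushable G S0 S \<omega>S'"
    "(\<omega>T, \<omega>T') \<in> orient_equiv b (delete G T)" "pushable G S0 T \<omega>T'"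
    "restrict_orientation \<omega>T' (delete G (S \<union> S0)) = restrict_orientation \<omega>S' (delete G (S \<union> S0))"
proof -
  have reflS: "(\<omega>S, \<omega>S) \<in> orient_equiv b (delete G S)" using self_in_orient_class[OF \<omega>S] by simp
  have reflT: "(\<omega>T, \<omega>T) \<in> orient_equiv b (delete G T)" using self_in_orient_class[OF \<omega>T] by simp
  consider "b = 0" | "edges (delete G S) \<subseteq> S0" | "b = 1" "\<not> edges (delete G S) \<subseteq> S0" using b by auto
  then show ?thesis
  proof cases
    case 1
    then have "pushable G S0 S \<omega>S" "pushable G S0 T \<omega>T"
      using \<omega>S \<omega>T orients_0_iff[OF wf_graph_delete[OF wf]] by (auto simp: pushable_def)
    moreover have "restrict_orientation \<omega>T (delete G (S \<union> S0)) = restrict_orientation \<omega>S (delete G (S \<union> S0))"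
      unfolding res[symmetric] by (auto simp: restrict_orientation_def)
    ultimately show ?thesis using that reflS reflT by blast
  next
    \<comment> \<open>Edges of \<open>G - T\<close> may survive although none of
      \<open>G - S\<close> does. The two representatives can then be chosen independently, since
      both restrictions are empty.\<close>
    case 2
    then have "pushable G S0 S \<omega>S" by (simp add: pushable_def)
    moreover obtain \<omega>T' where "(\<omega>T, \<omega>T') \<in> orient_equiv b (delete G T)" "pushable G S0 T \<omega>T'"
      using exists_pushable[OF wf b \<omega>T] .
    moreover have "edges (delete G (S \<union> S0)) = {}" using 2 by auto
    then have "restrict_orientation \<omega>T' (delete G (S \<union> S0)) = restrict_orientation \<omega>S (delete G (S \<union> S0))"
      for \<omega>T' unfolding restrict_orientation_def by blast
    ultimately show ?thesis using that reflS by blast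
  next
    case 3
    obtain \<omega>S' where \<omega>S': "(\<omega>S, \<omega>S') \<in> orient_equiv b (delete G S)" "pushable G S0 S \<omega>S'"
      using exists_pushable[OF wf b \<omega>S] .
    have "edges G - T - S = edges G - S" using TS by auto
    then have del: "delete (delete G T) S = delete G S" by (simp add: delete_def)
    have ne: "edges (delete (delete G T) S) \<noteq> {}" unfolding del using 3 by auto
    obtain \<omega>T' where \<omega>T': "(\<omega>T, \<omega>T') \<in> orient_equiv 1 (delete G T)"
      "restrict_orientation \<omega>T' (delete G S) = \<omega>S'" "bioriented \<omega>T' = bioriented \<omega>S'"
      using replace_on_subgraph[OF wf_graph_delete[OF wf, of T] _ ne, of \<omega>T \<omega>S'] \<omega>T \<omega>S'(1) 3(1) res
      unfolding del by auto
    then have "pushable G S0 T \<omega>T'" using \<omega>S'(2) 3 by (simp add: pushable_def)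
    moreover have "restrict_orientation \<omega>T' (delete G (S \<union> S0)) = restrict_orientation \<omega>S' (delete G (S \<union> S0))"
      unfolding \<omega>T'(2)[symmetric] by (auto simp: restrict_orientation_def)
    ultimately show ?thesis using that \<omega>S' \<omega>T'(1) 3(1) by blast
  qed
qed

lemma push_class_mono:
  assumes wf: "wf_graph G" and b: "b \<in> {0, 1}" and xy: "x \<in> OP b G" "y \<in> OP b G" "OP_le G x y"
  shows "OP_le (contract G S0) (push_class b G S0 x) (push_class b G S0 y)"
proof -
  obtain S C T D where x: "x = (S, C)" and y: "y = (T, D)" by (cases x; cases y)
  obtain \<omega>S \<omega>T where TS: "T \<subseteq> S" and \<omega>: "\<omega>S \<in> C" "\<omega>T \<in> D"
    and res: "restrict_orientation \<omega>T (delete G S) = \<omega>S"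
    using xy(3) unfolding x y by auto
  have S: "S \<in> adm_sets b G" and CQ: "C \<in> orients b (delete G S) // orient_equiv b (delete G S)"
    using xy(1) unfolding x by (auto simp: OP_def)
  have T: "T \<in> adm_sets b G" and DQ: "D \<in> orients b (delete G T) // orient_equiv b (delete G T)"
    using xy(2) unfolding y by (auto simp: OP_def)
  have C: "C = orient_class b (delete G S) \<omega>S" "\<omega>S \<in> orients b (delete G S)"
    using CQ \<omega>(1) by (auto elim!: quotientE dest: orient_class_eq simp: orient_equiv_def)
  have D: "D = orient_class b (delete G T) \<omega>T" "\<omega>T \<in> orients b (delete G T)"
    using DQ \<omega>(2) by (auto elim!: quotientE dest: orient_class_eq simp: orient_equiv_def)
  obtain \<omega>S' \<omega>T' where S': "(\<omega>S, \<omega>S') \<in> orient_equiv b (delete G S)" "pushable G S0 S \<omega>S'"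
    and T': "(\<omega>T, \<omega>T') \<in> orient_equiv b (delete G T)" "pushable G S0 T \<omega>T'"
    and res': "restrict_orientation \<omega>T' (delete G (S \<union> S0)) = restrict_orientation \<omega>S' (delete G (S \<union> S0))"
    using exists_compatible_pushable[OF wf b TS C(2) D(2) res] .
  have mem: "\<omega>S' \<in> orients b (delete G S)" "\<omega>T' \<in> orients b (delete G T)"
    using S'(1) T'(1) by (auto simp: orient_equiv_def)
  have "push_class b G S0 x =
      (S - S0, orient_class b (delete (contract G S0) (S - S0)) (push_orient G S0 S \<omega>S'))"
    unfolding x C orient_class_eq[OF S'(1)] by (rule push_class_eq_self[OF wf b S mem(1) S'(2)])
  moreover have "push_class b G S0 y =
      (T - S0, orient_class b (delete (contract G S0) (T - S0)) (push_orient G S0 T \<omega>T'))"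
    unfolding y D orient_class_eq[OF T'(1)] by (rule push_class_eq_self[OF wf b T mem(2) T'(2)])
  \<comment> \<open>Both sides keep exactly the targets on edges outside \<open>S\<close> and
    \<open>S0\<close>, where the two representatives agree.\<close>
  moreover have "restrict_orientation (push_orient G S0 T \<omega>T') (delete (contract G S0) (S - S0)) =
      push_orient G S0 S \<omega>S'"
  proof -
    have "restrict_orientation (push_orient G S0 T \<omega>T') (delete (contract G S0) (S - S0)) =
        restrict_orientation \<omega>T' (delete G (S \<union> S0))"
      using TS by (auto simp: push_orient_def restrict_orientation_def)
    also have "\<dots> = push_orient G S0 S \<omega>S'"
      unfolding res' by (auto simp: push_orient_def restrict_orientation_def)
    finally show ?thesis .
  qed
  ultimately show ?thesis
    using TS self_in_orient_class[OF push_orients[OF wf b S mem(1) S'(2)]]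
      self_in_orient_class[OF push_orients[OF wf b T mem(2) T'(2)]]
    by auto
qed

lemma push_class_morphism:
  assumes "wf_graph G" "b \<in> {0, 1}"
  shows "poset_morphism (OP b G) (OP_le G) (OP b (contract G S0)) (OP_le (contract G S0)) (push_class b G S0)"
  unfolding poset_morphism_def
  using push_class_in_OP[OF assms] push_class_mono[OF assms] by (auto simp: monotone_on_def)

section \<open>Composition of contractions\<close>

text \<open>When no edge is lost, restriction is the identity and every orientation is admissible.
  Quotient maps in both directions then give equalities.\<close>

lemma orient_equiv_isomorphic:
  assumes wf: "wf_graph G" and f: "quotient_map f G K" and edges: "edges K = edges G"
    and b: "b = 0 \<or> b = 1 \<and> connected_graph G"
  shows "orients b G \<subseteq> orients b K" "orient_equiv b G \<subseteq> orient_equiv b K"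
proof -
  interpret graph_quotient f G K using wf f by unfold_locales
  have *: "restrict_orientation \<omega> K = \<omega> \<and> admissible b \<omega>" if "\<omega> \<in> orients b G" for \<omega>
  proof -
    have "gen_orientation G \<omega>" using that by (rule gen_orientation_if_orients)
    then show ?thesis
      using bioriented_subset_edges[of G \<omega>] b edges
      by (auto simp: restrict_orientation_def gen_orientation_def admissible_def)
  qed
  show "orients b G \<subseteq> orients b K"
    using orients_quotient * by (metis subsetI)
  show "orient_equiv b G \<subseteq> orient_equiv b K"
  proof (rule subrelI)
    fix \<omega> \<omega>' assume eq: "(\<omega>, \<omega>') \<in> orient_equiv b G"
    then have "\<omega> \<in> orients b G" "\<omega>' \<in> orients b G" by (auto simp: orient_equiv_def)
    then show "(\<omega>, \<omega>') \<in> orient_equiv b K"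
      using orient_equiv_quotient[OF eq] * by simp
  qed
qed

text \<open>The vertex types may differ, but elements of \<open>OP\<close> consist of edges and
  half-edges only, so isomorphic graphs have literally comparable posets. Mutual quotient maps force
  equal edge sets.\<close>

lemma OP_isomorphic:
  assumes wf: "wf_graph G" and f: "quotient_map f G K" and g: "quotient_map g K G" and b: "b \<in> {0, 1}"
  shows "OP b G \<subseteq> OP b K"
    "S \<in> adm_sets b G \<Longrightarrow> orient_equiv b (delete G S) = orient_equiv b (delete K S)"
proof -
  have edges: "edges K = edges G" using quotient_mapD(2)[OF f] quotient_mapD(2)[OF g] by auto
  interpret graph_quotient f G K using wf f by unfold_locales
  have *: "S \<in> adm_sets b K \<and> orients b (delete G S) = orients b (delete K S) \<and>
      orient_equiv b (delete G S) = orient_equiv b (delete K S)" if S: "S \<in> adm_sets b G" for S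
  proof -
    have "S \<inter> edges K = S" using S edges by (auto simp: adm_sets_def)
    then have SK: "S \<in> adm_sets b K" using adm_sets_quotient[OF S] by simp
    have conn: "b = 0 \<or> b = 1 \<and> connected_graph (delete G S)" "b = 0 \<or> b = 1 \<and> connected_graph (delete K S)"
      using S SK b by (auto simp: adm_sets_def)
    have "quotient_map f (delete G S) (delete K S)" "quotient_map g (delete K S) (delete G S)"
      using quotient_map_delete f g by blast+
    moreover have "edges (delete K S) = edges (delete G S)" using edges by simp
    ultimately show ?thesis
      using SK orient_equiv_isomorphic[OF wf_graph_delete[OF wf] _ _ conn(1)]
        orient_equiv_isomorphic[OF wf_graph_delete[OF wf_K] _ _ conn(2)]
      by (metis subset_antisym)
  qed
  show "OP b G \<subseteq> OP b K" using * by (auto simp: OP_def)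
  show "S \<in> adm_sets b G \<Longrightarrow> orient_equiv b (delete G S) = orient_equiv b (delete K S)" using * by blast
qed

text \<open>Vertices of the iterated contraction are sets of sets, so the two graphs are compared by
  maps. One map factors the composite contraction through \<open>S \<union> T\<close>. The other
  factors the joint contraction first through \<open>S\<close>, then through
  \<open>T\<close>.\<close>

lemma contract_contract:
  assumes wf: "wf_graph G"
  obtains f g where "quotient_map f (contract G (S \<union> T)) (contract (contract G S) T)"
    "quotient_map g (contract (contract G S) T) (contract G (S \<union> T))"
proof -
  note qS = quotient_map_contract[OF wf, of S]
  have wfS: "wf_graph (contract G S)" by (rule wf_graph_quotient[OF qS wf])
  obtain f where f: "quotient_map f (contract G (S \<union> T)) (contract (contract G S) T)"
    by (rule quotient_map_factor[OF wf quotient_map_comp[OF qS quotient_map_contract[OF wfS, of T]], of "S \<union> T"])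
      auto
  obtain h where h: "quotient_map h (contract G S) (contract G (S \<union> T))"
    by (rule quotient_map_factor[OF wf quotient_map_contract[OF wf, of "S \<union> T"], of S]) auto
  obtain g where "quotient_map g (contract (contract G S) T) (contract G (S \<union> T))"
    by (rule quotient_map_factor[OF wfS h, of T]) auto
  with f show ?thesis by (rule that)
qed

lemma OP_contract_contract:
  assumes wf: "wf_graph G" and b: "b \<in> {0, 1}"
  shows "OP b (contract (contract G S0) T0) = OP b (contract G (S0 \<union> T0))"
    "S \<in> adm_sets b (contract G (S0 \<union> T0)) \<Longrightarrow> orient_equiv b (delete (contract G (S0 \<union> T0)) S) =
      orient_equiv b (delete (contract (contract G S0) T0) S)"
proof -
  obtain f g where f: "quotient_map f (contract G (S0 \<union> T0)) (contract (contract G S0) T0)"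
    and g: "quotient_map g (contract (contract G S0) T0) (contract G (S0 \<union> T0))"
    using contract_contract[OF wf] .
  have wf1: "wf_graph (contract G (S0 \<union> T0))" by (rule wf_graph_quotient[OF quotient_map_contract[OF wf] wf])
  have wf2: "wf_graph (contract (contract G S0) T0)" by (rule wf_graph_quotient[OF f wf1])
  show "OP b (contract (contract G S0) T0) = OP b (contract G (S0 \<union> T0))"
    using OP_isomorphic(1)[OF wf1 f g b] OP_isomorphic(1)[OF wf2 g f b] by simp
  show "S \<in> adm_sets b (contract G (S0 \<union> T0)) \<Longrightarrow> orient_equiv b (delete (contract G (S0 \<union> T0)) S) =
      orient_equiv b (delete (contract (contract G S0) T0) S)"
    by (rule OP_isomorphic(2)[OF wf1 f g b])
qed

text \<open>A single representative is made to serve all three push-forwards; on orientations both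
  sides are then restriction to the same edges.\<close>

lemma push_class_push_class:
  assumes wf: "wf_graph G" and b: "b \<in> {0, 1}" and x: "x \<in> OP b G"
  shows "push_class b G (S0 \<union> T0) x = push_class b (contract G S0) T0 (push_class b G S0 x)"
proof -
  let ?H = "contract G S0"
  obtain S \<omega> where S: "S \<in> adm_sets b G" and \<omega>: "\<omega> \<in> orients b (delete G S)"
    and p: "pushable G S0 S \<omega>" "pushable G (S0 \<union> T0) S \<omega>"
    and x: "x = (S, orient_class b (delete G S) \<omega>)"
  proof -
    obtain S \<omega> where S: "S \<in> adm_sets b G" "\<omega> \<in> orients b (delete G S)"
      "pushable G (S0 \<union> T0) S \<omega>" "x = (S, orient_class b (delete G S) \<omega>)"
      using OP_cases[OF wf b x] .
    show thesis
    proof (cases "bioriented \<omega> \<inter> (S0 \<union> T0) = {}")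
      case True
      then show thesis using that S by (auto simp: pushable_def)
    next
      case False
      \<comment> \<open>Every edge of \<open>G - S\<close> is contracted in the end, so all
        representatives qualify for \<open>S0 \<union> T0\<close>, and one can be chosen to suit
        \<open>S0\<close> alone.\<close>
      then have sub: "edges (delete G S) \<subseteq> S0 \<union> T0" using S(3) by (simp add: pushable_def)
      obtain \<omega>' where \<omega>': "(\<omega>, \<omega>') \<in> orient_equiv b (delete G S)" "pushable G S0 S \<omega>'"
        using exists_pushable[OF wf b S(2)] .
      then have "\<omega>' \<in> orients b (delete G S)" by (simp add: orient_equiv_def)
      moreover have "pushable G (S0 \<union> T0) S \<omega>'" using sub by (simp add: pushable_def)
      ultimately show thesis using that S(1,4) \<omega>' orient_class_eq[OF \<omega>'(1)] by metis
    qed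
  qed
  have wfH: "wf_graph ?H" by (rule wf_graph_quotient[OF quotient_map_contract[OF wf] wf])
  \<comment> \<open>If \<open>S0 \<union> T0\<close> contains all edges of \<open>G - S\<close>,
    those surviving the first contraction lie in \<open>T0\<close>. Otherwise the bioriented edges
    avoid \<open>T0\<close>.\<close>
  have pH: "pushable ?H T0 (S - S0) (push_orient G S0 S \<omega>)"
  proof (cases "edges (delete G S) \<subseteq> S0 \<union> T0")
    case False
    then show ?thesis
      using p(2) by (auto simp: pushable_def push_orient_def restrict_orientation_def bioriented_def)
  qed (auto simp: pushable_def)
  have "push_class b G (S0 \<union> T0) x = (S - (S0 \<union> T0),
      orient_class b (delete (contract G (S0 \<union> T0)) (S - (S0 \<union> T0))) (push_orient G (S0 \<union> T0) S \<omega>))"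
    unfolding x by (rule push_class_eq_self[OF wf b S \<omega> p(2)])
  also have "push_orient G (S0 \<union> T0) S \<omega> = push_orient ?H T0 (S - S0) (push_orient G S0 S \<omega>)"
    by (auto simp: push_orient_def restrict_orientation_def)
  also have "orient_equiv b (delete (contract G (S0 \<union> T0)) (S - (S0 \<union> T0))) =
      orient_equiv b (delete (contract ?H T0) (S - (S0 \<union> T0)))"
    by (rule OP_contract_contract(2)[OF wf b push_adm_sets[OF wf S]])
  also have "S - (S0 \<union> T0) = S - S0 - T0" by auto
  also have "(S - S0 - T0, orient_class b (delete (contract ?H T0) (S - S0 - T0))
        (push_orient ?H T0 (S - S0) (push_orient G S0 S \<omega>))) =
      push_class b ?H T0 (push_class b G S0 x)"
    unfolding x push_class_eq_self[OF wf b S \<omega> p(1)]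
    by (rule push_class_eq_self[OF wfH b push_adm_sets[OF wf S] push_orients[OF wf b S \<omega> p(1)] pH, symmetric])
  finally show ?thesis .
qed

theorem proposition2p3p3:
  fixes G :: "('v, 'e) mgraph" and S0 :: "'e set" and H :: "('v set, 'e) mgraph"
  assumes "wf_graph G" and "S0 \<subseteq> edges G" and "H = contract G S0"
  shows
    "(poset_morphism (OP 0 G) (OP_le G) (OP 0 H) (OP_le H) (push_class 0 G S0) \<and>
      (\<forall>S \<in> adm_sets 0 G. \<forall>\<omega> \<in> orients 0 (delete G S).
         push_class 0 G S0 (S, orient_class 0 (delete G S) \<omega>) =
           (S - S0, orient_class 0 (delete H (S - S0)) (push_orient G S0 S \<omega>)))) \<and>
     (S0 \<noteq> edges G \<longrightarrow>
      poset_morphism (OP 1 G) (OP_le G) (OP 1 H) (OP_le H) (push_class 1 G S0) \<and>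
      (\<forall>S \<in> adm_sets 1 G. \<forall>\<omega> \<in> orients 1 (delete G S). \<forall>\<omega>'.
         (\<omega>', \<omega>) \<in> orient_equiv 1 (delete G S) \<and>
         (bioriented \<omega>' \<inter> S0 = {} \<or> edges (delete G S) \<subseteq> S0) \<longrightarrow>
         push_class 1 G S0 (S, orient_class 1 (delete G S) \<omega>) =
           (S - S0, orient_class 1 (delete H (S - S0)) (push_orient G S0 S \<omega>')))) \<and>
     (\<forall>b \<in> {0, 1}. \<forall>T0 \<subseteq> edges H. (b = 1 \<longrightarrow> T0 \<noteq> edges H) \<longrightarrow>
      OP b (contract H T0) = OP b (contract G (S0 \<union> T0)) \<and>
      (\<forall>x \<in> OP b G. push_class b G (S0 \<union> T0) x = push_class b H T0 (push_class b G S0 x)))"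
proof (intro conjI impI)
  note wf = assms(1)
  have b: "(0::nat) \<in> {0, 1}" "(1::nat) \<in> {0, 1}" by auto
  show "poset_morphism (OP 0 G) (OP_le G) (OP 0 H) (OP_le H) (push_class 0 G S0)"
    "poset_morphism (OP 1 G) (OP_le G) (OP 1 H) (OP_le H) (push_class 1 G S0)"
    unfolding assms(3) using push_class_morphism[OF wf] b by blast+
  show "\<forall>S \<in> adm_sets 0 G. \<forall>\<omega> \<in> orients 0 (delete G S).
      push_class 0 G S0 (S, orient_class 0 (delete G S) \<omega>) =
        (S - S0, orient_class 0 (delete H (S - S0)) (push_orient G S0 S \<omega>))"
    unfolding assms(3)
  proof (intro ballI)
    fix S \<omega> assume S: "S \<in> adm_sets 0 G" and \<omega>: "\<omega> \<in> orients 0 (delete G S)"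
    \<comment> \<open>A 0-orientation has no bioriented edge, so every representative
      qualifies.\<close>
    then have "pushable G S0 S \<omega>"
      using orients_0_iff[OF wf_graph_delete[OF wf]] by (simp add: pushable_def)
    then show "push_class 0 G S0 (S, orient_class 0 (delete G S) \<omega>) =
        (S - S0, orient_class 0 (delete (contract G S0) (S - S0)) (push_orient G S0 S \<omega>))"
      by (rule push_class_eq_self[OF wf b(1) S \<omega>])
  qed
  show "\<forall>S \<in> adm_sets 1 G. \<forall>\<omega> \<in> orients 1 (delete G S). \<forall>\<omega>'.
      (\<omega>', \<omega>) \<in> orient_equiv 1 (delete G S) \<and>
      (bioriented \<omega>' \<inter> S0 = {} \<or> edges (delete G S) \<subseteq> S0) \<longrightarrow>
      push_class 1 G S0 (S, orient_class 1 (delete G S) \<omega>) =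
        (S - S0, orient_class 1 (delete H (S - S0)) (push_orient G S0 S \<omega>'))"
    unfolding assms(3) pushable_def[symmetric] using push_class_eq[OF wf b(2)] by blast
  show "\<forall>b \<in> {0, 1}. \<forall>T0 \<subseteq> edges H. (b = 1 \<longrightarrow> T0 \<noteq> edges H) \<longrightarrow>
      OP b (contract H T0) = OP b (contract G (S0 \<union> T0)) \<and>
      (\<forall>x \<in> OP b G. push_class b G (S0 \<union> T0) x = push_class b H T0 (push_class b G S0 x))"
    unfolding assms(3) using OP_contract_contract(1)[OF wf] push_class_push_class[OF wf] by blast
qed

end
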